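(* Let $\mathcal H$ be a nonzero real Hilbert space, let $L>0$, and let $f:\mathcal H\to\mathbb R$ be convex, differentiable and $L$-smooth. Let $x_\star\in\mathcal H$ be a minimizer of $f$. Fix an integer $N\ge 1$ and $R\ge 0$, and let $x_0\in\mathcal H$ satisfy $\|x_0-x_\star\|\le R$. Let $\theta_k=\frac{k+2}{2}$ for $k\ge 0$. Starting from $x_0=y_0=z_0$, define for $0\le k<N$ $$y_{k+1}=x_k-\tfrac1L\nabla f(x_k),\qquad z_{k+1}=z_k-\tfrac{\theta_k}{L}\nabla f(x_k),\qquad x_{k+1}=\Bigl(1-\tfrac1{\theta_{k+1}}\Bigr)y_{k+1}+\tfrac1{\theta_{k+1}}z_{k+1}.$$ Then $$f(y_N)-f(x_\star)\le \frac{2LR^2}{(N+2)(N+3)}.$$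
   Context: $L$-smooth means $\|\nabla f(x)-\nabla f(y)\|\le L\|x-y\|$ for all $x,y\in\mathcal H$. The iteration is the fast gradient method with rational coefficients. *)

theory Defs
  imports "HOL-Analysis.Analysis"
begin

(* Unspecified where no gradient exists. On a Hilbert space the Riesz representation
   theorem provides the unique gradient wherever f is Frechet differentiable. *)
definition gradient :: "('a::real_inner \<Rightarrow> real) \<Rightarrow> 'a \<Rightarrow> 'a" where
  "gradient f x = (THE D. GDERIV f x :> D)"

definition L_smooth :: "real \<Rightarrow> ('a::real_inner \<Rightarrow> real) \<Rightarrow> bool" where
  "L_smooth L f \<longleftrightarrow>
     (\<forall>x y. norm (gradient f x - gradient f y) \<le> L * norm (x - y))"

definition fgm_theta :: "nat \<Rightarrow> real" where
  "fgm_theta k = (real k + 2) / 2"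

end

theory Submission
  imports Defs
begin

text \<open>
Measure everything in units of \<open>L\<close>, and let \<open>g\<^sub>k\<close> be the gradient at \<open>x\<^sub>k\<close> for \<open>k < N\<close> and
\<open>g\<^sub>N\<close> the gradient at \<open>y\<^sub>N\<close>. Convexity and smoothness enter through the interpolation inequality
\<open>smooth_convex_interpolation\<close>. It is used with a weight \<open>w\<^sub>k\<close> to compare the minimizer
with the \<open>k\<close>-th point, and with the weight \<open>W\<^sub>k = w\<^sub>0 + \<dots> + w\<^sub>k\<close> to compare the \<open>k\<close>-th point with
the next one. With these cumulative weights all intermediate function values cancel.
With the total weight \<open>T = (N + 2) * (N + 3) / 4\<close> the sum reads

  \<open>T * (f y\<^sub>N - f x\<^sub>\<star>) \<le> V \<bullet> (x\<^sub>0 - x\<^sub>\<star>) - Q / 2\<close>,   \<open>V = w\<^sub>0 g\<^sub>0 + \<dots> + w\<^sub>N g\<^sub>N\<close>,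

where \<open>Q\<close> is a quadratic form in the gradients (\<open>dual_form\<close>). Because
\<open>V \<bullet> d - \<bar>V\<bar>\<^sup>2 / 2 \<le> \<bar>d\<bar>\<^sup>2 / 2\<close>, the rate \<open>R\<^sup>2 / (2 T)\<close> follows from \<open>\<bar>V\<bar>\<^sup>2 \<le> Q\<close>
(\<open>dual_form_ge\<close>), which is the heart of the matter.

For these pairs of points the weights are forced. The bound is attained by a Huber function in one
dimension that is affine along the whole trajectory, so \<open>Q - \<bar>V\<bar>\<^sup>2\<close> has to vanish when all gradients are
equal, and, being nonnegative, it has to be invariant under adding one vector to all gradients. This is a
linear system for the weights, with the rational solution \<open>cum_weight\<close> (\<open>row_sum\<close>). By the invariance
it suffices to show \<open>Q \<ge> 0\<close> for gradients with \<open>V = 0\<close> (\<open>dual_form_nonneg\<close>).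

In closed form the iterates are \<open>x\<^sub>0\<close> minus \<open>\<Sum>\<theta>\<^sub>j g\<^sub>j\<close> plus a multiple of \<open>\<Sum>\<phi>\<^sub>j g\<^sub>j\<close> with
\<open>\<phi>\<^sub>j = j (j + 1) (j + 2)\<close>. Hence the coefficient of \<open>g\<^sub>j \<bullet> g\<^sub>k\<close> in \<open>Q\<close>, for \<open>j < k\<close>, is
\<open>2 (w\<^sub>k \<theta>\<^sub>j + b\<^sub>k \<phi>\<^sub>j)\<close>, and two summations by parts apply. The \<open>\<phi>\<close> part is nonnegative up to diagonal
terms because \<open>b\<^sub>k / \<phi>\<^sub>k\<close> decreases. For the \<open>\<theta>\<close> part, \<open>\<theta>\<^sub>k\<close> is almost proportional to \<open>w\<^sub>k\<close>: if it
were proportional, the sum would telescope, and the relative deviation (\<open>slope\<close>) lies between \<open>0\<close>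
and roughly \<open>3 / N\<close>. After centring, what remains is at most a multiple of the total variation of
\<open>\<bar>V\<^sub>k\<bar>\<^sup>2\<close> along the closed path of partial sums \<open>V\<^sub>k\<close> of \<open>V\<close>, and a discrete Opial inequality
(\<open>total_variation_square_norm\<close>) bounds that variation by half the squared length of the path. The
diagonal terms collapse to \<open>W\<^sub>k \<bar>g\<^sub>k\<bar>\<^sup>2\<close>, and by the Cauchy--Schwarz inequality they pay for this
length. All inequalities between the weights reduce to polynomials in \<open>k\<close> and \<open>N - k\<close> with
nonnegative coefficients.
\<close>

section \<open>Gradients of smooth convex functions on a Hilbert space\<close>

text \<open>
The Riesz representation theorem: \<open>\<phi>\<close> is represented by the minimizer of \<open>\<bar>x\<bar>\<^sup>2 / 2 - \<phi> x\<close>. A minimizing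
sequence is Cauchy by the parallelogram law, and the first-order condition at its limit is the
representation.
\<close>

lemma riesz_representation:
  fixes \<phi> :: "'a::{real_inner, complete_space} \<Rightarrow> real"
  assumes "bounded_linear \<phi>"
  shows "\<exists>a. \<forall>h. \<phi> h = h \<bullet> a"
proof -
  interpret \<phi>: bounded_linear \<phi> by fact
  define J where "J x = x \<bullet> x / 2 - \<phi> x" for x
  obtain K where K: "\<And>x. norm (\<phi> x) \<le> norm x * K"
    using \<phi>.bounded by blast
  have J_ge: "- (K\<^sup>2) / 2 \<le> J x" for x
  proof -
    have "\<phi> x \<le> norm x * K" using K[of x] by simp
    moreover have "0 \<le> (norm x - K)\<^sup>2" by simp
    ultimately show ?thesis
      by (simp add: J_def power2_norm_eq_inner [symmetric] power2_diff)
  qed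
  have bdd: "bdd_below (range J)"
    using J_ge by (intro bdd_belowI2) auto
  define m where "m = (INF x. J x)"
  have m_le: "m \<le> J x" for x
    unfolding m_def by (rule cINF_lower[OF bdd]) simp
  have "\<exists>x. J x < m + inverse (real (Suc n))" for n
  proof -
    have "m < m + inverse (real (Suc n))" by simp
    then show ?thesis unfolding m_def
      by (subst (asm) cINF_less_iff) (use bdd in auto)
  qed
  then obtain X where X: "\<And>n. J (X n) < m + inverse (real (Suc n))" by metis
  \<comment> \<open>the parallelogram law, combined with the lower bound \<open>m\<close> at the midpoint\<close>
  have quad: "(norm (x - y))\<^sup>2 \<le> 4 * (J x + J y - 2 * m)" for x y
  proof -
    have "J x + J y - 2 * J ((1/2) *\<^sub>R (x + y)) = (norm (x - y))\<^sup>2 / 4"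
      by (simp add: J_def power2_norm_eq_inner \<phi>.scaleR \<phi>.add inner_diff inner_add
          inner_commute algebra_simps)
    with m_le[of "(1/2) *\<^sub>R (x + y)"] show ?thesis by simp
  qed
  have "Cauchy X"
  proof (rule metric_CauchyI)
    fix e :: real assume "0 < e"
    then obtain n0 where n0: "inverse (real (Suc n0)) < e\<^sup>2 / 8"
      using reals_Archimedean[of "e\<^sup>2 / 8"] by auto
    have "dist (X i) (X j) < e" if "i \<ge> n0" "j \<ge> n0" for i j
    proof -
      have le: "inverse (real (Suc k)) \<le> inverse (real (Suc n0))" if "k \<ge> n0" for k
        using that by (simp add: field_simps)
      define q where "q = inverse (real (Suc n0))"
      have "J (X i) < m + q" "J (X j) < m + q" "8 * q < e\<^sup>2"
        using less_le_trans[OF X add_left_mono[OF le[OF that(1)]]]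
          less_le_trans[OF X add_left_mono[OF le[OF that(2)]]] n0 by (simp_all add: q_def)
      then have "(norm (X i - X j))\<^sup>2 < e\<^sup>2"
        using quad[of "X i" "X j"] by argo
      then show ?thesis
        using \<open>0 < e\<close> by (simp add: dist_norm power2_less_imp_less)
    qed
    then show "\<exists>M. \<forall>i\<ge>M. \<forall>j\<ge>M. dist (X i) (X j) < e" by blast
  qed
  then obtain a where a: "X \<longlonglongrightarrow> a"
    using Cauchy_convergent convergent_def by blast
  have "(\<lambda>n. J (X n)) \<longlonglongrightarrow> J a"
    unfolding J_def by (intro tendsto_intros a \<phi>.tendsto) simp
  moreover have "(\<lambda>n. m + inverse (real (Suc n))) \<longlonglongrightarrow> m + 0"
    by (intro tendsto_intros LIMSEQ_inverse_real_of_nat)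
  ultimately have "J a \<le> m"
    using X by (intro LIMSEQ_le[of "\<lambda>n. J (X n)" _ "\<lambda>n. m + inverse (real (Suc n))"])
      (auto intro!: exI[of _ 0] less_imp_le)
  have "\<phi> h = h \<bullet> a" for h
  proof (rule ccontr)
    assume ne: "\<phi> h \<noteq> h \<bullet> a"
    define d where "d = \<phi> h - h \<bullet> a"
    have "h \<noteq> 0" using ne by (auto simp: \<phi>.zero)
    then have hh: "h \<bullet> h > 0" by simp
    \<comment> \<open>the step that minimizes \<open>J\<close> along \<open>h\<close>\<close>
    define t where "t = d / (h \<bullet> h)"
    have "J (a + t *\<^sub>R h) = J a - t * d + t\<^sup>2 * (h \<bullet> h) / 2"
      by (simp add: J_def d_def \<phi>.scaleR \<phi>.add inner_add inner_commute algebra_simps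
          power2_eq_square)
    also have "\<dots> = J a - d\<^sup>2 / (2 * (h \<bullet> h))"
      using hh by (simp add: t_def field_simps power2_eq_square)
    also have "\<dots> < J a" using hh ne by (simp add: d_def)
    finally show False using m_le[of "a + t *\<^sub>R h"] \<open>J a \<le> m\<close> by linarith
  qed
  then show ?thesis by blast
qed

text \<open>
Frechet differentiability gives only a bounded functional as derivative. Completeness of the space turns
it into a vector, which makes the definite description in \<open>gradient\<close> meaningful.
\<close>

lemma gderiv_gradient:
  fixes f :: "'a::{real_inner, complete_space} \<Rightarrow> real"
  assumes "f differentiable (at x)"
  shows "GDERIV f x :> gradient f x"
proof -
  obtain f' where f': "(f has_derivative f') (at x)"
    using assms by (auto simp: differentiable_def)
  obtain a where "\<forall>h. f' h = h \<bullet> a"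
    using riesz_representation[OF has_derivative_bounded_linear[OF f']] by blast
  then have a: "GDERIV f x :> a"
    using f' by (metis (no_types, lifting) ext gderiv_def)
  have "b = a" if "GDERIV f x :> b" for b
  proof -
    have "(\<lambda>h. h \<bullet> b) = (\<lambda>h. h \<bullet> a)"
      using that a unfolding gderiv_def by (rule has_derivative_unique)
    then have "(b - a) \<bullet> b = (b - a) \<bullet> a" by metis
    then have "(b - a) \<bullet> (b - a) = 0" by (simp add: inner_diff_right)
    then show ?thesis by simp
  qed
  then show ?thesis
    unfolding gradient_def using a by (metis (no_types, lifting) theI)
qed

lemma DERIV_along_line:
  assumes "GDERIV f (u + t *\<^sub>R d) :> D"
  shows "((\<lambda>s. f (u + s *\<^sub>R d)) has_real_derivative d \<bullet> D) (at t)"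
proof -
  have "((\<lambda>s. u + s *\<^sub>R d) has_derivative (\<lambda>s. s *\<^sub>R d)) (at t)"
    by (auto intro!: derivative_eq_intros)
  from has_derivative_compose[OF this assms[unfolded gderiv_def]]
  show ?thesis
    by (simp add: has_field_derivative_def o_def mult.commute)
       (metis (no_types, lifting) ext mult.commute)
qed

lemma descent_lemma:
  fixes f :: "'a::real_inner \<Rightarrow> real"
  assumes grad: "\<And>x. GDERIV f x :> gradient f x" and smooth: "L_smooth L f"
  shows "f w \<le> f u + gradient f u \<bullet> (w - u) + L / 2 * (norm (w - u))\<^sup>2"
proof -
  define d where "d = w - u"
  define h where "h t = f (u + t *\<^sub>R d) - t * (d \<bullet> gradient f u) - L * t\<^sup>2 / 2 * (norm d)\<^sup>2" for t
  have "h 1 \<le> h 0"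
  proof (rule DERIV_nonpos_imp_nonincreasing[of 0 1 h])
    fix t :: real assume t: "0 \<le> t" "t \<le> 1"
    let ?D = "d \<bullet> gradient f (u + t *\<^sub>R d) - d \<bullet> gradient f u - L * t * (norm d)\<^sup>2"
    have "(h has_real_derivative ?D) (at t)"
      unfolding h_def by (auto intro!: derivative_eq_intros DERIV_along_line grad)
    moreover have "d \<bullet> (gradient f (u + t *\<^sub>R d) - gradient f u)
        \<le> norm d * norm (gradient f (u + t *\<^sub>R d) - gradient f u)"
      by (rule norm_cauchy_schwarz)
    moreover have "norm (gradient f (u + t *\<^sub>R d) - gradient f u) \<le> L * (t * norm d)"
      using smooth t unfolding L_smooth_def by (metis add_diff_cancel_left' norm_scaleR abs_of_nonneg)
    then have "norm d * norm (gradient f (u + t *\<^sub>R d) - gradient f u) \<le> norm d * (L * (t * norm d))"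
      by (rule mult_left_mono) simp
    ultimately have "?D \<le> 0" by (simp add: inner_diff_right power2_eq_square mult_ac)
    with \<open>(h has_real_derivative ?D) (at t)\<close>
    show "\<exists>y. (h has_real_derivative y) (at t) \<and> y \<le> 0" by blast
  qed simp
  then show ?thesis by (simp add: h_def d_def inner_commute)
qed

lemma convex_above_tangent:
  fixes f :: "'a::real_inner \<Rightarrow> real"
  assumes grad: "\<And>x. GDERIV f x :> gradient f x" and cvx: "convex_on UNIV f"
  shows "f v + gradient f v \<bullet> (w - v) \<le> f w"
proof -
  define h where "h t = f (v + t *\<^sub>R (w - v))" for t
  have cvx_h: "convex_on UNIV h"
  proof (rule convex_onI)
    fix t x y :: real assume t: "0 < t" "t < 1"
    have "v + ((1 - t) *\<^sub>R x + t *\<^sub>R y) *\<^sub>R (w - v)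
        = (1 - t) *\<^sub>R (v + x *\<^sub>R (w - v)) + t *\<^sub>R (v + y *\<^sub>R (w - v))"
      by (simp add: algebra_simps)
    then show "h ((1 - t) *\<^sub>R x + t *\<^sub>R y) \<le> (1 - t) * h x + t * h y"
      unfolding h_def using convex_onD[OF cvx, of t] t by (metis UNIV_I less_imp_le)
  qed simp
  have "(h has_real_derivative (w - v) \<bullet> gradient f v) (at 0)"
    using DERIV_along_line[of f v 0 "w - v" "gradient f v"] grad by (simp add: h_def[abs_def])
  then have "h 1 - h 0 \<ge> (w - v) \<bullet> gradient f v * (1 - 0)"
    by (intro convex_on_imp_above_tangent[OF cvx_h]) auto
  then show ?thesis by (simp add: h_def inner_commute)
qed

text \<open>
The strengthened convexity inequality. Replace \<open>u\<close> by the point \<open>w\<close> reached from \<open>u\<close> by a step of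
length \<open>1 / L\<close> along the negative of \<open>\<delta> = \<nabla>f u - \<nabla>f v\<close>: the value at \<open>w\<close> lies above the tangent at \<open>v\<close>
and below the quadratic upper model at \<open>u\<close>. This step maximizes the resulting gain, \<open>\<bar>\<delta>\<bar>\<^sup>2 / (2 L)\<close>.
\<close>

lemma smooth_convex_interpolation:
  fixes f :: "'a::real_inner \<Rightarrow> real"
  assumes "L > 0" and grad: "\<And>x. GDERIV f x :> gradient f x"
    and cvx: "convex_on UNIV f" and smooth: "L_smooth L f"
  shows "f v + gradient f v \<bullet> (u - v) + (norm (gradient f u - gradient f v))\<^sup>2 / (2 * L) \<le> f u"
proof -
  define \<delta> where "\<delta> = gradient f u - gradient f v"
  define w where "w = u - (1 / L) *\<^sub>R \<delta>"
  have "f v + gradient f v \<bullet> (w - v) \<le> f w"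
    by (rule convex_above_tangent[OF grad cvx])
  also have "\<dots> \<le> f u + gradient f u \<bullet> (w - u) + L / 2 * (norm (w - u))\<^sup>2"
    by (rule descent_lemma[OF grad smooth])
  finally have step: "f v + gradient f v \<bullet> (w - v)
      \<le> f u + gradient f u \<bullet> (w - u) + L / 2 * (norm (w - u))\<^sup>2" .
  have "gradient f v \<bullet> (w - v) = gradient f v \<bullet> (u - v) - gradient f v \<bullet> \<delta> / L"
    "gradient f u \<bullet> (w - u) = - (gradient f u \<bullet> \<delta> / L)"
    by (simp_all add: w_def inner_diff_right algebra_simps)
  moreover have "gradient f u \<bullet> \<delta> / L - gradient f v \<bullet> \<delta> / L = \<delta> \<bullet> \<delta> / L"
    by (simp add: \<delta>_def inner_diff_left diff_divide_distrib)
  moreover have "L / 2 * (norm (w - u))\<^sup>2 = (norm \<delta>)\<^sup>2 / (2 * L)"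
    using \<open>L > 0\<close> by (simp add: w_def power_mult_distrib power2_eq_square field_simps)
  moreover have "\<delta> \<bullet> \<delta> / L = 2 * ((norm \<delta>)\<^sup>2 / (2 * L))"
    by (simp add: power2_norm_eq_inner)
  ultimately show ?thesis using step unfolding \<delta>_def[symmetric] by linarith
qed

lemma gradient_at_minimizer:
  fixes f :: "'a::real_inner \<Rightarrow> real"
  assumes "L > 0" and grad: "\<And>x. GDERIV f x :> gradient f x" and smooth: "L_smooth L f"
    and minimizer: "\<And>u. f xs \<le> f u"
  shows "gradient f xs = 0"
proof -
  define w where "w = xs - (1 / L) *\<^sub>R gradient f xs"
  have "f xs \<le> f xs + gradient f xs \<bullet> (w - xs) + L / 2 * (norm (w - xs))\<^sup>2"
    using minimizer[of w] descent_lemma[OF grad smooth, of w xs] by linarith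
  also have "gradient f xs \<bullet> (w - xs) = - ((norm (gradient f xs))\<^sup>2 / L)"
    by (simp add: w_def power2_norm_eq_inner)
  also have "L / 2 * (norm (w - xs))\<^sup>2 = (norm (gradient f xs))\<^sup>2 / (2 * L)"
    using \<open>L > 0\<close> by (simp add: w_def power_mult_distrib power2_eq_square field_simps)
  finally have "(norm (gradient f xs))\<^sup>2 / (2 * L) \<le> 0" by (simp add: field_simps)
  then show ?thesis using \<open>L > 0\<close> by (simp add: divide_le_0_iff)
qed

section \<open>Two summation inequalities\<close>

text \<open>
A discrete form of Opial's inequality. On a closed path through the origin of length \<open>L\<close>, the
distance to the origin after travelling \<open>s\<close> is at most \<open>min s (L - s)\<close>, from either end of the path. The
variation of the squared norm is then at most \<open>2 \<integral> min s (L - s) ds = L\<^sup>2 / 2\<close>. Working with the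
antiderivative \<open>G\<close> of twice the minimum makes the discrete sum telescope; each step is a trapezoidal
sum, which lies below the integral of a concave function.
\<close>

lemma total_variation_square_norm:
  fixes V :: "nat \<Rightarrow> 'a::real_normed_vector"
  assumes V0: "V 0 = 0" and Vn: "V n = 0"
  shows "(\<Sum>k<n. \<bar>(norm (V (Suc k)))\<^sup>2 - (norm (V k))\<^sup>2\<bar>)
    \<le> (\<Sum>k<n. norm (V (Suc k) - V k))\<^sup>2 / 2"
proof -
  define S where "S k = (\<Sum>j<k. norm (V (Suc j) - V j))" for k
  define L where "L = S n"
  define G where "G s = (if s \<le> L / 2 then s\<^sup>2 else L\<^sup>2 / 2 - (L - s)\<^sup>2)" for s
  have S_Suc: "S (Suc k) = S k + norm (V (Suc k) - V k)" for k
    by (simp add: S_def)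
  have left: "norm (V k) \<le> S k" for k
  proof (induction k)
    case (Suc k)
    have "norm (V (Suc k)) \<le> norm (V k) + norm (V (Suc k) - V k)"
      by (metis add.commute diff_add_cancel norm_triangle_ineq)
    with Suc show ?case by (simp add: S_Suc)
  qed (simp add: V0 S_def)
  have right: "norm (V k) \<le> L - S k" if "k \<le> n" for k
    using that
  proof (induction rule: inc_induct)
    case (step k)
    have "norm (V k) \<le> norm (V (Suc k)) + norm (V (Suc k) - V k)"
      by (metis add.commute diff_add_cancel norm_minus_commute norm_triangle_ineq)
    with step show ?case by (simp add: S_Suc)
  qed (simp add: Vn L_def)
  have "\<bar>(norm (V (Suc k)))\<^sup>2 - (norm (V k))\<^sup>2\<bar> \<le> G (S (Suc k)) - G (S k)" if "k < n" for k
  proof -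
    define a b u v where "a = S k" and "b = S (Suc k)" and "u = norm (V k)" and "v = norm (V (Suc k))"
    have ab: "a \<le> b" by (simp add: a_def b_def S_Suc)
    have uv: "0 \<le> u" "0 \<le> v" "u \<le> a" "u \<le> L - a" "v \<le> b" "v \<le> L - b"
      using left[of k] left[of "Suc k"] right[of k] right[of "Suc k"] that
      by (simp_all add: a_def b_def u_def v_def)
    have "\<bar>v\<^sup>2 - u\<^sup>2\<bar> = \<bar>v - u\<bar> * (v + u)"
      using uv by (simp add: abs_mult power2_eq_square square_diff_square_factored mult.commute)
    also have "\<bar>v - u\<bar> \<le> b - a"
      using norm_triangle_ineq3[of "V (Suc k)" "V k"] by (simp add: u_def v_def a_def b_def S_Suc)
    finally have var: "\<bar>v\<^sup>2 - u\<^sup>2\<bar> \<le> (b - a) * (v + u)"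
      using uv by (simp add: mult_right_mono)
    have bound: "(b - a) * (v + u) \<le> (b - a) * c" if "v + u \<le> c" for c
      using that ab by (intro mult_left_mono) auto
    consider "b \<le> L / 2" | "L / 2 < a" | "a \<le> L / 2" "L / 2 < b" by linarith
    then have "(b - a) * (v + u) \<le> G b - G a"
    proof cases
      case 1
      then show ?thesis
        using ab bound[of "b + a"] uv by (simp add: G_def power2_eq_square algebra_simps)
    next
      case 2
      then show ?thesis
        using ab bound[of "(L - b) + (L - a)"] uv by (simp add: G_def power2_eq_square algebra_simps)
    next
      case 3
      have "0 \<le> (L / 2 - a) * (b - L / 2)" using 3 by simp
      then show ?thesis
        using 3 bound[of "(L - b) + a"] uv by (simp add: G_def power2_eq_square algebra_simps)
    qed
    with var show ?thesis by (simp add: a_def b_def u_def v_def)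
  qed
  then have "(\<Sum>k<n. \<bar>(norm (V (Suc k)))\<^sup>2 - (norm (V k))\<^sup>2\<bar>) \<le> (\<Sum>k<n. G (S (Suc k)) - G (S k))"
    by (intro sum_mono) auto
  also have "\<dots> = G L - G 0"
    by (subst sum_lessThan_telescope) (simp add: L_def S_def)
  also have "\<dots> \<le> L\<^sup>2 / 2"
  proof -
    have "0 \<le> L" by (simp add: L_def S_def sum_nonneg)
    then show ?thesis by (simp add: G_def power2_eq_square)
  qed
  finally show ?thesis by (simp add: L_def S_def)
qed

text \<open>
Since \<open>c\<^sub>k h\<^sub>k\<close> is the increment of \<open>\<Phi>\<close>, the \<open>k\<close>-th summand is \<open>b\<^sub>k / c\<^sub>k\<close> times the increment of
\<open>\<bar>\<Phi>\<bar>\<^sup>2\<close>, and for decreasing \<open>b\<^sub>k / c\<^sub>k\<close> only the last square survives. At index \<open>0\<close> the quotient is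
\<open>b\<^sub>0 / 0 = 0\<close>, which is consistent because \<open>\<Phi>\<^sub>1 = 0\<close>.
\<close>

lemma summation_by_parts_decreasing:
  fixes h :: "nat \<Rightarrow> 'a::real_inner" and c b :: "nat \<Rightarrow> real"
  defines "\<Phi> \<equiv> \<lambda>k. \<Sum>j<k. c j *\<^sub>R h j"
  assumes c0: "c 0 = 0" and c_pos: "\<And>k. 0 < k \<Longrightarrow> 0 < c k"
    and decay: "\<And>k. Suc k < n \<Longrightarrow> c k * b (Suc k) \<le> c (Suc k) * b k"
  shows "b (n - 1) / c (n - 1) * (norm (\<Phi> n))\<^sup>2
    \<le> (\<Sum>k<n. 2 * b k * (h k \<bullet> \<Phi> k) + c k * b k * (norm (h k))\<^sup>2)"
  using decay
proof (induction n)
  case 0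
  then show ?case by (simp add: \<Phi>_def)
next
  case (Suc n)
  have IH: "b (n - 1) / c (n - 1) * (norm (\<Phi> n))\<^sup>2
      \<le> (\<Sum>k<n. 2 * b k * (h k \<bullet> \<Phi> k) + c k * b k * (norm (h k))\<^sup>2)"
    using Suc by auto
  show ?case
  proof (cases "n = 0")
    case True
    then show ?thesis by (simp add: c0 \<Phi>_def)
  next
    case False
    then have cn: "0 < c n" using c_pos by simp
    have step: "b n / c n * (norm (\<Phi> (Suc n)))\<^sup>2 = b n / c n * (norm (\<Phi> n))\<^sup>2
        + (2 * b n * (h n \<bullet> \<Phi> n) + c n * b n * (norm (h n))\<^sup>2)"
    proof -
      have Phi_Suc: "\<Phi> (Suc n) = \<Phi> n + c n *\<^sub>R h n" by (simp add: \<Phi>_def)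
      have "(norm (\<Phi> (Suc n)))\<^sup>2 = (norm (\<Phi> n))\<^sup>2 + 2 * c n * (h n \<bullet> \<Phi> n) + (c n)\<^sup>2 * (norm (h n))\<^sup>2"
        unfolding Phi_Suc power2_norm_eq_inner
        by (simp add: inner_add_left inner_add_right inner_commute power2_eq_square algebra_simps)
      then show ?thesis
        using cn by (simp add: field_simps power2_eq_square)
    qed
    have "b n / c n * (norm (\<Phi> n))\<^sup>2 \<le> b (n - 1) / c (n - 1) * (norm (\<Phi> n))\<^sup>2"
    proof (cases "n = 1")
      case True
      then show ?thesis by (simp add: \<Phi>_def c0)
    next
      case n1: False
      obtain i where i: "n = Suc i" "0 < i" using False n1 by (cases n) auto
      have "c i * b (Suc i) \<le> c (Suc i) * b i" using Suc.prems i by auto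
      then have "b n / c n \<le> b (n - 1) / c (n - 1)"
        using c_pos[of i] c_pos[of n] i by (simp add: divide_simps mult.commute)
      then show ?thesis by (rule mult_right_mono) simp
    qed
    with IH step show ?thesis by simp
  qed
qed

lemma quadratic_nonneg:
  fixes u v :: "'a::real_inner"
  assumes "0 \<le> p" "0 < q" "r\<^sup>2 \<le> p * q"
  shows "0 \<le> p * (norm u)\<^sup>2 + 2 * r * (v \<bullet> u) + q * (norm v)\<^sup>2"
proof -
  have "0 \<le> (norm (q *\<^sub>R v + r *\<^sub>R u))\<^sup>2 + (p * q - r\<^sup>2) * (norm u)\<^sup>2"
    using assms by simp
  also have "\<dots> = q * (p * (norm u)\<^sup>2 + 2 * r * (v \<bullet> u) + q * (norm v)\<^sup>2)"
    unfolding power2_norm_eq_inner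
    by (simp add: inner_add_left inner_add_right inner_commute power2_eq_square algebra_simps)
  finally show ?thesis
    using \<open>0 < q\<close> by (simp add: zero_le_mult_iff)
qed

section \<open>Polynomial inequalities behind the weights\<close>

text \<open>
The bound to be proved is \<open>L R\<^sup>2 / (2 T)\<close> for this \<open>T\<close>.
\<close>

definition total_weight :: "nat \<Rightarrow> real" where
  "total_weight N = (real N + 2) * (real N + 3) / 4"

text \<open>
Numerator and, below, denominator of the rational function in the cumulative weights. Their form is
dictated by the linear system \<open>row_identity\<close>, which has the weights as its solution.
\<close>

definition weight_num :: "real \<Rightarrow> real \<Rightarrow> real" where
  "weight_num n x = 2 * (x + 3) * (n * (n + 1)) - (x - 1) * (x + 1) * (x + 2)"

definition weight_den :: "real \<Rightarrow> real \<Rightarrow> real" where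
  "weight_den n x = 2 * (n\<^sup>2 + 5 * n + 2) - (x - 1) * (x + 6)"

text \<open>
With \<open>p\<close> and \<open>d\<close> for the two preceding functions, this is the numerator of the difference
\<open>p x / ((x + 1) * d x) - p (x + 1) / ((x + 2) * d (x + 1))\<close> over the common denominator, and
\<open>increment_num\<close> is the one of \<open>(x + 1) * p (x + 1) / d (x + 1) - x * p x / d x\<close>.
\<close>

definition momentum_num :: "real \<Rightarrow> real \<Rightarrow> real" where
  "momentum_num n x = (x + 2) * weight_num n x * weight_den n (x + 1) - (x + 1) * weight_num n (x + 1) * weight_den n x"

definition increment_num :: "real \<Rightarrow> real \<Rightarrow> real" where
  "increment_num n x = (x + 1) * weight_num n (x + 1) * weight_den n x - x * weight_num n x * weight_den n (x + 1)"

text \<open>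
Here and in the following lemmas \<open>x\<close> stands for an index \<open>k\<close> and \<open>n\<close> for \<open>N\<close>. The range of the index
is encoded by \<open>n = x + c + m\<close> with \<open>m \<ge> 0\<close>. In the variables \<open>x\<close> and \<open>m\<close> the difference of the two
sides is a polynomial without negative coefficients, so that its sign is evident.
\<close>

lemma weight_den_pos:
  fixes x m :: real
  assumes "0 \<le> x" "0 \<le> m" "n = x + m"
  shows "0 < weight_den n x"
proof -
  have "weight_den n x =
      ((x + 5) * x) + (4 * x + 10) * m + 2 * m ^ 2 + 10"
    unfolding assms(3) weight_den_def by algebra
  also have "0 < \<dots>"
    using assms(1,2) by (intro add_nonneg_pos add_nonneg_nonneg mult_nonneg_nonneg zero_le_power) simp_all
  finally show ?thesis by simp
qed

lemma increment_num_lower: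
  fixes x m :: real
  assumes "0 \<le> x" "0 \<le> m" "n = x + 1 + m"
  shows "2 * (x + 2) * (n * (n + 1)) * weight_den n x * weight_den n (x + 1) \<le> (n + 2) * (n + 3) * increment_num n x"
proof -
  have "(n + 2) * (n + 3) * increment_num n x
      - 2 * (x + 2) * (n * (n + 1)) * weight_den n x * weight_den n (x + 1) =
      ((((((6 * x + 86) * x + 526) * x + 1770) * x + 3436) * x + 3520) * x + 1408) + (((((44 *
      x + 542) * x + 2676) * x + 6446) * x + 7316) * x + 3008) * m + ((((114 * x + 1064) * x +
      3566) * x + 4872) * x + 2176) * m ^ 2 + (((112 * x + 696) * x + 1272) * x + 640) * m ^ 3
      + ((36 * x + 108) * x + 64) * m ^ 4"
    unfolding assms(3) weight_num_def weight_den_def momentum_num_def increment_num_def by algebra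
  also have "0 \<le> \<dots>"
    using assms(1,2) by (intro add_nonneg_nonneg mult_nonneg_nonneg zero_le_power) simp_all
  finally show ?thesis by simp
qed

lemma increment_num_upper:
  fixes x m :: real
  assumes "0 \<le> x" "0 \<le> m" "n = x + 1 + m"
  shows "(n + 2) * (n + 3) * (n + 5) * increment_num n x \<le> 2 * (x + 2) * (n + 8) * (n * (n + 1)) * weight_den n x * weight_den n (x + 1)"
proof -
  have "2 * (x + 2) * (n + 8) * (n * (n + 1)) * weight_den n x * weight_den n (x + 1)
      - (n + 2) * (n + 3) * (n + 5) * increment_num n x =
      ((((((4 * x + 92) * x + 684) * x + 2228) * x + 3152) * x + 1520) * x) + ((((((10 * x +
      134) * x + 866) * x + 3202) * x + 7164) * x + 9648) * x + 5984) * m + (((((64 * x + 722)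
      * x + 3748) * x + 11326) * x + 19356) * x + 13840) * m ^ 2 + ((((158 * x + 1600) * x +
      6826) * x + 14240) * x + 11504) * m ^ 3 + (((188 * x + 1548) * x + 4496) * x + 4352) * m
      ^ 4 + ((108 * x + 588) * x + 752) * m ^ 5 + (24 * x + 48) * m ^ 6"
    unfolding assms(3) weight_num_def weight_den_def momentum_num_def increment_num_def by algebra
  also have "0 \<le> \<dots>"
    using assms(1,2) by (intro add_nonneg_nonneg mult_nonneg_nonneg zero_le_power) simp_all
  finally show ?thesis by simp
qed

lemma momentum_num_nonneg:
  fixes x m :: real
  assumes "0 \<le> x" "0 \<le> m" "n = x + 1 + m"
  shows "0 \<le> momentum_num n x"
proof -
  have "momentum_num n x =
      (((16 * x + 96) * x + 176) * x + 96) + (((8 * x + 76) * x + 244) * x + 216) * m + ((28 *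
      x + 156) * x + 208) * m ^ 2 + (32 * x + 80) * m ^ 3 + 8 * m ^ 4"
    unfolding assms(3) weight_num_def weight_den_def momentum_num_def increment_num_def by algebra
  also have "0 \<le> \<dots>"
    using assms(1,2) by (intro add_nonneg_nonneg mult_nonneg_nonneg zero_le_power) simp_all
  finally show ?thesis by simp
qed

lemma weight_num_growth:
  fixes x m :: real
  assumes "0 \<le> x" "0 \<le> m" "n = x + 2 + m"
  shows "x * (x + 3) * weight_num n x * weight_den n (x + 1) \<le> (x\<^sup>2 + 2 * x + 3) * weight_num n (x + 1) * weight_den n x"
proof -
  have "(x\<^sup>2 + 2 * x + 3) * weight_num n (x + 1) * weight_den n x
      - x * (x + 3) * weight_num n x * weight_den n (x + 1) =
      (((((4 * x + 78) * x + 740) * x + 3390) * x + 7116) * x + 5472) + ((((24 * x + 436) * x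
      + 2760) * x + 7420) * x + 7152) * m + (((52 * x + 624) * x + 2516) * x + 3360) * m ^ 2 +
      ((32 * x + 304) * x + 672) * m ^ 3 + (8 * x + 48) * m ^ 4"
    unfolding assms(3) weight_num_def weight_den_def momentum_num_def increment_num_def by algebra
  also have "0 \<le> \<dots>"
    using assms(1,2) by (intro add_nonneg_nonneg mult_nonneg_nonneg zero_le_power) simp_all
  finally show ?thesis by simp
qed

lemma momentum_num_decay:
  fixes x m :: real
  assumes "0 \<le> x" "0 \<le> m" "n = x + 2 + m"
  shows "momentum_num n (x + 1) * (x * (x + 1)) * weight_den n x \<le> momentum_num n x * (x + 3)\<^sup>2 * weight_den n (x + 2)"
proof -
  have "momentum_num n x * (x + 3)\<^sup>2 * weight_den n (x + 2)
      - momentum_num n (x + 1) * (x * (x + 1)) * weight_den n x =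
      (((((((8 * x + 192) * x + 2448) * x + 18368) * x + 80136) * x + 197504) * x + 253536) *
      x + 131328) + ((((((72 * x + 1980) * x + 21308) * x + 116252) * x + 339708) * x +
      502696) * x + 293760) * m + (((((372 * x + 7572) * x + 59316) * x + 222076) * x +
      394616) * x + 264528) * m ^ 2 + ((((896 * x + 13120) * x + 69312) * x + 154544) * x +
      120816) * m ^ 3 + (((1008 * x + 9872) * x + 30496) * x + 28800) * m ^ 4 + ((480 * x +
      2704) * x + 3312) * m ^ 5 + (80 * x + 144) * m ^ 6"
    unfolding assms(3) weight_num_def weight_den_def momentum_num_def increment_num_def by algebra
  also have "0 \<le> \<dots>"
    using assms(1,2) by (intro add_nonneg_nonneg mult_nonneg_nonneg zero_le_power) simp_all
  finally show ?thesis by simp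
qed

section \<open>The dual weights\<close>

definition oblong :: "nat \<Rightarrow> real" where
  "oblong N = real N * (real N + 1)"

text \<open>
\<open>W\<^sub>k\<^sub>-\<^sub>1 / (k (k + 1))\<close> with the removable singularity at \<open>k = 0\<close> filled in. The value beyond \<open>N\<close> has
\<open>N (N + 1)\<close> in place of \<open>(N + 1) (N + 2)\<close>: the last point is \<open>y\<^sub>N\<close>, for which the momentum step is
omitted, and in \<open>fgm_positions\<close> the coefficient for \<open>y\<^sub>N\<close> differs from that for \<open>x\<^sub>N\<close> in the same way.
\<close>

definition weight_ratio :: "nat \<Rightarrow> nat \<Rightarrow> real" where
  "weight_ratio N k = (if k \<le> N
     then total_weight N * weight_num (real N) (real k) / (oblong N * (real k + 1) * weight_den (real N) (real k))
     else total_weight N / oblong N)"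

text \<open>
Sum of the weights with index below \<open>k\<close>, so \<open>W\<^sub>k\<close> is the value at \<open>Suc k\<close>.
\<close>

definition cum_weight :: "nat \<Rightarrow> nat \<Rightarrow> real" where
  "cum_weight N k = (if k \<le> N then real k * (real k + 1) * weight_ratio N k else total_weight N)"

definition weight :: "nat \<Rightarrow> nat \<Rightarrow> real" where
  "weight N k = cum_weight N (Suc k) - cum_weight N k"

text \<open>
The coefficient \<open>b\<^sub>k\<close> of \<open>\<Sum>\<phi>\<^sub>j g\<^sub>j\<close> in the terms of the certificate that contain \<open>g\<^sub>k\<close>. That it is
a difference of consecutive values of one sequence is what makes sums of \<open>b\<^sub>k\<close> explicit.
\<close>

definition momentum :: "nat \<Rightarrow> nat \<Rightarrow> real" where
  "momentum N k = (weight_ratio N k - weight_ratio N (Suc k)) / 2"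

definition cubic :: "nat \<Rightarrow> real" where
  "cubic k = real k * (real k + 1) * (real k + 2)"

lemma cum_weight_0 [simp]: "cum_weight N 0 = 0"
  by (simp add: cum_weight_def)

lemma cum_weight_end [simp]: "cum_weight N (Suc N) = total_weight N"
  by (simp add: cum_weight_def)

lemma total_weight_pos: "0 < total_weight N"
  by (simp add: total_weight_def)

lemma oblong_pos: "0 < N \<Longrightarrow> 0 < oblong N"
  by (simp add: oblong_def)

lemma weight_den_pos_nat: "k \<le> N \<Longrightarrow> 0 < weight_den (real N) (real k)"
  by (rule weight_den_pos[of "real k" "real N - real k"]) auto

lemma weight_den_pos_nat': "k < N \<Longrightarrow> 0 < weight_den (real N) (real k + 1)"
  using weight_den_pos_nat[of "Suc k" N] by (simp add: add.commute)

lemma cum_weight_eq: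
  assumes "0 < N" "k \<le> N"
  shows "cum_weight N k = total_weight N * real k * weight_num (real N) (real k) / (oblong N * weight_den (real N) (real k))"
  using assms weight_den_pos_nat[of k N] oblong_pos[of N]
  by (simp add: cum_weight_def weight_ratio_def divide_simps)

lemma weight_eq:
  assumes "k < N"
  shows "weight N k = total_weight N * increment_num (real N) (real k)
    / (oblong N * weight_den (real N) (real k) * weight_den (real N) (real k + 1))"
proof -
  have *: "T * (x + 1) * p' / (M * d') - T * x * p / (M * d)
      = T * ((x + 1) * p' * d - x * p * d') / (M * d * d')"
    if "M > 0" "d > 0" "d' > 0" for T p M x d p' d' :: real
    using that by (simp add: divide_simps) algebra
  have S: "real (Suc k) = real k + 1" by simp
  show ?thesis
    unfolding weight_def increment_num_def
    using assms weight_den_pos_nat[of k N] weight_den_pos_nat'[of k N] oblong_pos[of N]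
    by (simp add: cum_weight_eq S * del: of_nat_Suc)
qed

lemma momentum_eq:
  assumes "k < N"
  shows "momentum N k = total_weight N * momentum_num (real N) (real k)
    / (2 * oblong N * ((real k + 1) * (real k + 2)) * weight_den (real N) (real k) * weight_den (real N) (real k + 1))"
proof -
  have *: "(T * p / (M * y * d) - T * p' / (M * z * d')) / 2
      = T * (z * p * d' - y * p' * d) / (2 * M * (y * z) * d * d')"
    if "M > 0" "d > 0" "d' > 0" "y > 0" "z > 0" for T p M y z d p' d' :: real
    using that by (simp add: divide_simps) algebra
  have S: "real (Suc k) = real k + 1" and S': "real k + 1 + 1 = real k + 2" by simp_all
  have "momentum N k = (total_weight N * weight_num (real N) (real k) / (oblong N * (real k + 1) * weight_den (real N) (real k))
     - total_weight N * weight_num (real N) (real k + 1) / (oblong N * (real k + 2) * weight_den (real N) (real k + 1))) / 2"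
    using assms unfolding momentum_def weight_ratio_def S S' by simp
  then show ?thesis
    unfolding momentum_num_def
    by (subst (asm) *) (use assms weight_den_pos_nat[of k N] weight_den_pos_nat'[of k N] oblong_pos[of N] in simp_all)
qed

lemma weight_ge:
  assumes "k < N"
  shows "fgm_theta k \<le> weight N k"
proof -
  let ?x = "real k" and ?n = "real N"
  have "2 * (?x + 2) * (?n * (?n + 1)) * weight_den ?n ?x * weight_den ?n (?x + 1)
      \<le> (?n + 2) * (?n + 3) * increment_num ?n ?x"
    by (rule increment_num_lower[of _ "?n - ?x - 1"]) (use assms in auto)
  then have "(?x + 2) / 2 * (oblong N * weight_den ?n ?x * weight_den ?n (?x + 1))
      \<le> total_weight N * increment_num ?n ?x"
    unfolding total_weight_def oblong_def by argo
  then show ?thesis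
    using assms weight_den_pos_nat[of k N] weight_den_pos_nat'[of k N] oblong_pos[of N]
    unfolding weight_eq[OF assms] fgm_theta_def
    by (subst pos_le_divide_eq) simp_all
qed

text \<open>
Together with the lower bound \<open>weight_ge\<close> this says that \<open>1 - \<theta>\<^sub>k / w\<^sub>k\<close> lies between \<open>0\<close> and \<open>3 / (N + 8)\<close>.
The upper bound is an equality for \<open>N = 1\<close>, \<open>k = 0\<close>.
\<close>

lemma weight_le:
  assumes "k < N"
  shows "(real N + 5) * weight N k \<le> (real N + 8) * fgm_theta k"
proof -
  let ?x = "real k" and ?n = "real N"
  have "(?n + 2) * (?n + 3) * (?n + 5) * increment_num ?n ?x
      \<le> 2 * (?x + 2) * (?n + 8) * (?n * (?n + 1)) * weight_den ?n ?x * weight_den ?n (?x + 1)"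
    by (rule increment_num_upper[of _ "?n - ?x - 1"]) (use assms in auto)
  then have "(?n + 5) * (total_weight N * increment_num ?n ?x)
      \<le> (?n + 8) * ((?x + 2) / 2) * (oblong N * weight_den ?n ?x * weight_den ?n (?x + 1))"
    unfolding total_weight_def oblong_def by argo
  then show ?thesis
    using assms weight_den_pos_nat[of k N] weight_den_pos_nat'[of k N] oblong_pos[of N]
    unfolding weight_eq[OF assms] fgm_theta_def times_divide_eq_right
    by (subst pos_divide_le_eq) simp_all
qed

text \<open>
This identity identifies \<open>b\<^sub>k\<close> as the coefficient produced by the positions of the
iterates, and it makes the diagonal of the quadratic form collapse to \<open>W\<^sub>k\<close>.
\<close>

lemma cubic_momentum:
  assumes "k < N"
  shows "cubic k * momentum N k = cum_weight N k - real k * weight N k / 2"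
proof -
  have S: "real (Suc k) = real k + 1" and S': "real k + 1 + 1 = real k + 2" by simp_all
  have "cum_weight N k = real k * (real k + 1) * weight_ratio N k"
    "cum_weight N (Suc k) = (real k + 1) * (real k + 2) * weight_ratio N (Suc k)"
    using assms unfolding cum_weight_def S S' by simp_all
  then show ?thesis
    unfolding momentum_def weight_def cubic_def by algebra
qed

lemma momentum_end:
  assumes "0 < N"
  shows "momentum N N = - weight N N / (2 * oblong N)"
proof -
  have "cum_weight N N = oblong N * weight_ratio N N" "weight_ratio N (Suc N) = total_weight N / oblong N"
    by (simp_all add: cum_weight_def oblong_def weight_ratio_def[of N "Suc N"])
  then show ?thesis
    using oblong_pos[OF assms] by (simp add: momentum_def weight_def field_simps)
qed

lemma weight_end:
  assumes "0 < N"
  shows "weight N N = 2 * total_weight N / (total_weight N + 1)"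
proof -
  let ?T = "total_weight N" and ?n = "real N"
  have "weight_den ?n ?n = 4 * (?T + 1)"
    unfolding weight_den_def total_weight_def by (simp add: field_simps power2_eq_square)
  moreover have "?n * weight_num ?n ?n = 4 * oblong N * (?T - 1)"
    unfolding weight_num_def total_weight_def oblong_def by (simp add: field_simps power2_eq_square)
  ultimately have "cum_weight N N = ?T * (4 * oblong N * (?T - 1)) / (oblong N * (4 * (?T + 1)))"
    using assms by (simp add: cum_weight_eq mult.assoc)
  also have "\<dots> = ?T * (?T - 1) / (?T + 1)"
    using oblong_pos[OF assms] total_weight_pos[of N] by (simp add: divide_simps) algebra
  finally show ?thesis
    using total_weight_pos[of N] by (simp add: weight_def divide_simps) algebra
qed

lemma momentum_last:
  assumes "0 < N"
  shows "momentum N (N - 1) = weight N N * (real N + 2) / (oblong N * ((real N)\<^sup>2 + 7 * real N + 14))"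
proof -
  define n where "n = real N"
  have n: "n > 0" using assms by (simp add: n_def)
  have k: "real (N - 1) = n - 1" using assms by (simp add: n_def of_nat_diff)
  have k': "n - 1 + 1 = n" "n * (n - 1 + 2) = oblong N"
    by (simp_all add: oblong_def n_def)
  have d1: "weight_den n n = 4 * (total_weight N + 1)"
    unfolding weight_den_def total_weight_def n_def[symmetric] by (simp add: field_simps power2_eq_square)
  have d0: "weight_den n (n - 1) = n\<^sup>2 + 7 * n + 14"
    unfolding weight_den_def by algebra
  have c: "momentum_num n (n - 1) = 16 * oblong N * (n + 2)"
    unfolding momentum_num_def weight_den_def weight_num_def oblong_def n_def[symmetric] by algebra
  have pos: "n\<^sup>2 + 7 * n + 14 > 0" using n by (simp add: add_pos_pos)
  have *: "T * (16 * M * a) / (2 * M * M * q * (4 * (T + 1))) = 2 * T / (T + 1) * a / (M * q)"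
    if "T > 0" "M > 0" "q > 0" for T M a q :: real
    using that by (simp add: divide_simps)
  have momentum: "momentum N (N - 1) = total_weight N * (16 * oblong N * (n + 2))
    / (2 * oblong N * oblong N * (n\<^sup>2 + 7 * n + 14) * (4 * (total_weight N + 1)))"
    unfolding momentum_eq[OF assms[THEN diff_less[OF zero_less_one]]] k n_def[symmetric] k' c d0 d1 ..
  show ?thesis
    by (simp only: momentum *[OF total_weight_pos oblong_pos[OF assms] pos] weight_end[OF assms] flip: n_def)
qed

section \<open>Identities and monotonicity of the weights\<close>

text \<open>
The equations that determine the weights. If all gradients are equal, the terms of the quadratic form
containing \<open>g\<^sub>k\<close> must balance \<open>w\<^sub>k V\<close>. The sums over smaller indices of \<open>\<theta>\<^sub>j\<close> and \<open>\<phi>\<^sub>j\<close>, and the sums over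
larger indices of \<open>w\<^sub>j\<close> and \<open>b\<^sub>j\<close>, appear here in closed form.
\<close>

lemma row_identity:
  assumes "k < N"
  shows "2 * cum_weight N (Suc k) + weight N k * (real k * (real k + 3) / 4)
      + momentum N k * ((real k - 1) * real k * (real k + 1) * (real k + 2) / 4)
      + fgm_theta k * (total_weight N - cum_weight N (Suc k))
      + cubic k * ((weight_ratio N (Suc k) - total_weight N / oblong N) / 2)
    = total_weight N * weight N k"
proof -
  define n x M T where "n = real N" and "x = real k" and "M = oblong N" and "T = total_weight N"
  define p d p' d' where "p = weight_num n x" and "d = weight_den n x" and "p' = weight_num n (x + 1)" and "d' = weight_den n (x + 1)"
  have pos: "d > 0" "d' > 0" "M > 0"
    using weight_den_pos_nat[of k N] weight_den_pos_nat'[of k N] oblong_pos[of N] assms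
    by (simp_all add: d_def d'_def n_def x_def M_def)
  define u v where "u = T * p / (M * d)" and "v = T * p' / (M * d')"
  have S: "real (Suc k) = x + 1" and S': "x + 1 + 1 = x + 2" by (simp_all add: x_def)
  have x: "x + 1 > 0" "x + 2 > 0" by (simp_all add: x_def)
  have r0: "weight_ratio N k = u / (x + 1)" and r1: "weight_ratio N (Suc k) = v / (x + 2)"
    using assms unfolding weight_ratio_def S S' u_def v_def T_def p_def d_def p'_def d'_def M_def
    by (simp_all add: n_def x_def)
  have c0: "cum_weight N k = x * u" and c1: "cum_weight N (Suc k) = (x + 1) * v"
    using assms x unfolding cum_weight_def r0 r1 S S' by (simp_all add: x_def)
  \<comment> \<open>the claim is \<open>A u + B v + C T / M = 0\<close>: linear in the two values of the weight ratio\<close>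
  define A B C where
    "A = - (x\<^sup>2 * (x + 3) / 4) + (x + 2) * (x - 1) * x / 8 + T * x" and
    "B = 2 * (x + 1) + (x + 1) * x * (x + 3) / 4 - (x + 1) * (x - 1) * x / 8
        - (x + 2) * (x + 1) / 2 + x * (x + 1) / 2 - T * (x + 1)" and
    "C = M * (x + 2) / 2 - x * (x + 1) * (x + 2) / 2"
  have key: "A * p * d' + B * p' * d + C * d * d' = 0"
    unfolding A_def B_def C_def p_def d_def p'_def d'_def T_def total_weight_def M_def oblong_def
      weight_num_def weight_den_def n_def[symmetric] by (simp add: field_simps) algebra
  define z where "z = T / M"
  have "A * u + B * v + C * z = T / (M * d * d') * (A * p * d' + B * p' * d + C * d * d')"
    using pos unfolding u_def v_def z_def by (simp add: divide_simps) algebra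
  then have E0: "A * u + B * v + C * z = 0" by (simp add: key)
  have E1: "C * z = (x + 2) / 2 * T - x * (x + 1) * (x + 2) * z / 2"
    using pos unfolding C_def z_def by (simp add: divide_simps) algebra
  have E2: "(u / (x + 1) - v / (x + 2)) / 2 * ((x - 1) * x * (x + 1) * (x + 2) / 4)
      = ((x + 2) * u - (x + 1) * v) * (x - 1) * x / 8"
    using x by (simp add: divide_simps) algebra
  have E3: "x * (x + 1) * (x + 2) * ((v / (x + 2) - z) / 2)
      = x * (x + 1) * v / 2 - x * (x + 1) * (x + 2) * z / 2"
    using x by (simp add: divide_simps) algebra
  show ?thesis
    using E0 E1
    unfolding weight_def momentum_def r0 r1 c0 c1 cubic_def fgm_theta_def x_def[symmetric]
      M_def[symmetric] T_def[symmetric] z_def[symmetric] E2 E3 A_def B_def power2_eq_square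
    by argo
qed

lemma row_identity_end:
  assumes "0 < N"
  shows "total_weight N + weight N N * (real N * (real N + 3) / 4)
      + momentum N N * ((real N - 1) * real N * (real N + 1) * (real N + 2) / 4)
    = total_weight N * weight N N"
proof -
  define n T where "n = real N" and "T = total_weight N"
  have n: "n > 0" using assms by (simp add: n_def)
  have T: "T + 1 > 0" using total_weight_pos[of N] by (simp add: T_def)
  have "momentum N N * ((n - 1) * n * (n + 1) * (n + 2) / 4) = - weight N N * ((n - 1) * (n + 2) / 8)"
    using n unfolding momentum_end[OF assms] oblong_def n_def[symmetric] by (simp add: divide_simps) algebra
  moreover have gap: "T - n * (n + 3) / 4 + (n - 1) * (n + 2) / 8 = (T + 1) / 2"
    unfolding T_def total_weight_def n_def[symmetric] by (simp add: field_simps power2_eq_square)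
  have "weight N N * (T - n * (n + 3) / 4 + (n - 1) * (n + 2) / 8) = T"
    unfolding gap weight_end[OF assms] T_def[symmetric] using T by simp
  ultimately show ?thesis
    unfolding n_def[symmetric] T_def[symmetric] by argo
qed

lemma momentum_nonneg:
  assumes "k < N"
  shows "0 \<le> momentum N k"
proof -
  have "0 \<le> momentum_num (real N) (real k)"
    by (rule momentum_num_nonneg[of _ "real N - real k - 1"]) (use assms in auto)
  then show ?thesis
    using assms weight_den_pos_nat[of k N] weight_den_pos_nat'[of k N] oblong_pos[of N] total_weight_pos[of N]
    unfolding momentum_eq[OF assms] by (intro divide_nonneg_nonneg mult_nonneg_nonneg) auto
qed

text \<open>
The quotient \<open>b\<^sub>k / \<phi>\<^sub>k\<close> decreases, stated without division because \<open>\<phi>\<^sub>0 = 0\<close>.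
\<close>

lemma momentum_decay:
  assumes "Suc k < N"
  shows "cubic k * momentum N (Suc k) \<le> cubic (Suc k) * momentum N k"
proof -
  define n x where "n = real N" and "x = real k"
  define d0 d1 d2 where "d0 = weight_den n x" and "d1 = weight_den n (x + 1)" and "d2 = weight_den n (x + 2)"
  define R R' where "R = momentum_num n x" and "R' = momentum_num n (x + 1)"
  define T M where "T = total_weight N" and "M = oblong N"
  have S: "real (Suc k) = x + 1" and S': "x + 1 + 1 = x + 2" "x + 1 + 2 = x + 3"
    by (simp_all add: x_def)
  have x: "x \<ge> 0" by (simp add: x_def)
  have pos: "d0 > 0" "d1 > 0" "d2 > 0" "M > 0" "T > 0"
    using assms weight_den_pos_nat[of k N] weight_den_pos_nat'[of k N] weight_den_pos_nat'[of "Suc k" N] oblong_pos[of N] total_weight_pos[of N]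
    unfolding d0_def d1_def d2_def M_def T_def S S' by (simp_all add: n_def x_def)
  have "R' * (x * (x + 1)) * d0 \<le> R * (x + 3)\<^sup>2 * d2"
    unfolding R_def R'_def d0_def d2_def
    by (rule momentum_num_decay[of _ "n - x - 2"]) (use assms in \<open>auto simp: n_def x_def\<close>)
  then have "T / (2 * M * (x + 3) * d0 * d1 * d2) * (R' * (x * (x + 1)) * d0)
      \<le> T / (2 * M * (x + 3) * d0 * d1 * d2) * (R * (x + 3)\<^sup>2 * d2)"
    using pos x by (intro mult_left_mono) auto
  moreover have "cubic k * momentum N (Suc k) = T / (2 * M * (x + 3) * d0 * d1 * d2) * (R' * (x * (x + 1)) * d0)"
    unfolding momentum_eq[OF assms] cubic_def S S' x_def[symmetric] n_def[symmetric] T_def[symmetric]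
      M_def[symmetric] d0_def[symmetric] d1_def[symmetric] d2_def[symmetric] R'_def[symmetric]
    using pos x by (simp add: divide_simps)
  moreover have "cubic (Suc k) * momentum N k = T / (2 * M * (x + 3) * d0 * d1 * d2) * (R * (x + 3)\<^sup>2 * d2)"
    unfolding momentum_eq[OF Suc_lessD[OF assms]] cubic_def S S' x_def[symmetric] n_def[symmetric] T_def[symmetric]
      M_def[symmetric] d0_def[symmetric] d1_def[symmetric] d2_def[symmetric] R_def[symmetric]
    using pos x by (simp add: divide_simps power2_eq_square)
  ultimately show ?thesis by simp
qed

text \<open>
The quotient \<open>w\<^sub>k / \<phi>\<^sub>k\<close> decreases. Nonnegativity of \<open>b\<^sub>k\<^sub>+\<^sub>1\<close> bounds \<open>w\<^sub>k\<^sub>+\<^sub>1\<close> by a multiple of \<open>W\<^sub>k\<close>,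
so that only \<open>W\<^sub>k\<close> and \<open>w\<^sub>k\<close> have to be compared, which takes polynomials of lower degree.
\<close>

lemma weight_growth:
  assumes "Suc k < N"
  shows "real k * weight N (Suc k) \<le> (real k + 3) * weight N k"
proof -
  define n x where "n = real N" and "x = real k"
  define d0 d1 where "d0 = weight_den n x" and "d1 = weight_den n (x + 1)"
  define T M where "T = total_weight N" and "M = oblong N"
  have S: "real (Suc k) = x + 1" by (simp add: x_def)
  have x: "x \<ge> 0" by (simp add: x_def)
  have pos: "d0 > 0" "d1 > 0" "M > 0" "T > 0"
    using assms weight_den_pos_nat[of k N] weight_den_pos_nat'[of k N] oblong_pos[of N] total_weight_pos[of N]
    unfolding d0_def d1_def M_def T_def by (simp_all add: n_def x_def)
  have "x * (x + 3) * weight_num n x * d1 \<le> (x\<^sup>2 + 2 * x + 3) * weight_num n (x + 1) * d0"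
    unfolding d0_def d1_def
    by (rule weight_num_growth[of _ "n - x - 2"]) (use assms in \<open>auto simp: n_def x_def\<close>)
  then have "T * (x + 1) / (M * d0 * d1) * (x * (x + 3) * weight_num n x * d1)
      \<le> T * (x + 1) / (M * d0 * d1) * ((x\<^sup>2 + 2 * x + 3) * weight_num n (x + 1) * d0)"
    using pos x by (intro mult_left_mono) auto
  moreover have "T * (x + 1) / (M * d0 * d1) * (x * (x + 3) * weight_num n x * d1) = (x + 1) * (x + 3) * cum_weight N k"
    using assms pos by (simp add: cum_weight_eq divide_simps flip: x_def n_def T_def M_def d0_def)
  moreover have "T * (x + 1) / (M * d0 * d1) * ((x\<^sup>2 + 2 * x + 3) * weight_num n (x + 1) * d0)
      = (x\<^sup>2 + 2 * x + 3) * cum_weight N (Suc k)"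
    using assms pos by (simp add: cum_weight_eq S divide_simps del: of_nat_Suc flip: n_def T_def M_def d1_def)
  ultimately have "(x + 1) * (x + 3) * cum_weight N k \<le> (x\<^sup>2 + 2 * x + 3) * cum_weight N (Suc k)"
    by simp
  then have "2 * x * cum_weight N (Suc k) \<le> (x + 1) * (x + 3) * weight N k"
    unfolding weight_def by (simp add: algebra_simps power2_eq_square)
  moreover have "(x + 1) * weight N (Suc k) \<le> 2 * cum_weight N (Suc k)"
    using cubic_momentum[OF assms] momentum_nonneg[OF assms] mult_nonneg_nonneg[of "cubic (Suc k)" "momentum N (Suc k)"]
    unfolding S by (simp add: cubic_def)
  then have "x * ((x + 1) * weight N (Suc k)) \<le> x * (2 * cum_weight N (Suc k))"
    using x by (rule mult_left_mono)
  ultimately have "(x + 1) * (x * weight N (Suc k)) \<le> (x + 1) * ((x + 3) * weight N k)"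
    by (simp add: mult_ac)
  then show ?thesis
    using x by (simp add: x_def)
qed

lemma cum_weight_ge: "k \<le> N \<Longrightarrow> real k * (real k + 3) / 4 \<le> cum_weight N k"
proof (induction k)
  case (Suc k)
  then have "real k * (real k + 3) / 4 + fgm_theta k \<le> cum_weight N k + weight N k"
    using weight_ge[of k N] by (intro add_mono) auto
  then show ?case by (simp add: fgm_theta_def weight_def field_simps)
qed simp

text \<open>
Up to the factor \<open>((N + 8) / (N + 5))\<^sup>2\<close> this is \<open>\<theta>\<^sub>k\<^sup>2 \<le> \<theta>\<^sub>0 + \<dots> + \<theta>\<^sub>k\<close>, the basic growth condition on the
step sizes of accelerated methods.
\<close>

lemma weight_square_le:
  assumes "k < N"
  shows "(weight N k)\<^sup>2 \<le> ((real N + 8) / (real N + 5))\<^sup>2 * cum_weight N (Suc k)"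
proof -
  have th: "0 < fgm_theta k" by (simp add: fgm_theta_def)
  have "weight N k \<le> (real N + 8) / (real N + 5) * fgm_theta k"
    using weight_le[OF assms] by (simp add: field_simps)
  then have "(weight N k)\<^sup>2 \<le> ((real N + 8) / (real N + 5) * fgm_theta k)\<^sup>2"
    using weight_ge[OF assms] th by (intro power_mono) auto
  also have "\<dots> = ((real N + 8) / (real N + 5))\<^sup>2 * (fgm_theta k)\<^sup>2"
    by (rule power_mult_distrib)
  also have "(fgm_theta k)\<^sup>2 \<le> real (Suc k) * (real (Suc k) + 3) / 4"
    by (simp add: fgm_theta_def field_simps power2_eq_square)
  also have "\<dots> \<le> cum_weight N (Suc k)"
    using assms by (intro cum_weight_ge) auto
  finally show ?thesis by (simp add: mult_left_mono)
qed

section \<open>Deviation of the step sizes from the weights\<close>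

text \<open>
The cross coefficients \<open>w\<^sub>k \<theta>\<^sub>j + b\<^sub>k \<phi>\<^sub>j\<close> do not change when \<open>b\<close> is replaced by \<open>b + t w\<close> and \<open>\<theta>\<close> by
\<open>\<theta> - t \<phi>\<close>. A small positive \<open>t\<close> enlarges \<open>b\<close> near \<open>k = N - 1\<close> and brings \<open>b\<^sub>N < 0\<close> closer to zero, as
\<open>cross_budget\<close> requires; for \<open>t = 0\<close> that estimate fails, by a factor that
approaches two as \<open>N\<close> grows. Too large a \<open>t\<close>
would spoil \<open>slope_budget\<close>. The choice here, of order \<open>N\<^sup>-\<^sup>4\<close>, satisfies both for every \<open>N\<close>.
\<close>

definition tilt :: "nat \<Rightarrow> real" where
  "tilt N = 3 / (2 * oblong N * total_weight N)"

text \<open>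
If all slopes were equal, the summation by parts in \<open>dual_form_lower_bound\<close> would telescope.
\<close>

definition slope :: "nat \<Rightarrow> nat \<Rightarrow> real" where
  "slope N k = 1 - (fgm_theta k - tilt N * cubic k) / weight N k"

definition slope_bound :: "nat \<Rightarrow> real" where
  "slope_bound N = 3 / (real N + 8) + 3 * (real N - 1) / (total_weight N * (real N + 1))"

text \<open>
The coefficient left for \<open>\<bar>g\<^sub>N\<bar>\<^sup>2\<close> after the telescoping part of the form has used \<open>w\<^sub>N\<^sup>2\<close> of it. A share
of \<open>1 / N\<close> goes to the path length in \<open>slope_budget\<close> and the rest to the mixed term in \<open>cross_budget\<close>.
\<close>

definition end_slack :: "nat \<Rightarrow> real" where
  "end_slack N = total_weight N - (weight N N)\<^sup>2"

lemma weight_pos: "k < N \<Longrightarrow> 0 < weight N k"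
  using weight_ge[of k N] by (simp add: fgm_theta_def add_pos_pos less_le_trans)

lemma tilt_pos: "0 < N \<Longrightarrow> 0 < tilt N"
  by (simp add: tilt_def oblong_pos total_weight_pos)

lemma slope_nonneg:
  assumes "k < N"
  shows "0 \<le> slope N k"
proof -
  have "0 \<le> tilt N * cubic k"
    using assms tilt_pos[of N] by (simp add: cubic_def)
  then have "fgm_theta k - tilt N * cubic k \<le> weight N k"
    using weight_ge[OF assms] by linarith
  then show ?thesis
    using weight_pos[OF assms] by (simp add: slope_def)
qed

lemma slope_le:
  assumes "k < N"
  shows "slope N k \<le> slope_bound N"
proof -
  have w: "0 < weight N k" by (rule weight_pos[OF assms])
  have th: "0 < fgm_theta k" by (simp add: fgm_theta_def)
  have N: "0 < N" using assms by simp
  have "1 - fgm_theta k / weight N k \<le> 3 / (real N + 8)"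
    using weight_le[OF assms] w by (simp add: field_simps)
  moreover have "tilt N * cubic k / weight N k \<le> tilt N * cubic k / fgm_theta k"
    using weight_ge[OF assms] th tilt_pos[OF N] by (intro divide_left_mono) (auto simp: cubic_def)
  moreover have "tilt N * cubic k / fgm_theta k = tilt N * (2 * (real k * (real k + 1)))"
    by (simp add: cubic_def fgm_theta_def field_simps)
  moreover have "tilt N * (2 * (real k * (real k + 1))) \<le> tilt N * (2 * ((real N - 1) * (real N - 1 + 1)))"
    using assms tilt_pos[OF N] by (intro mult_left_mono mult_mono add_right_mono) auto
  moreover have "tilt N * (2 * ((real N - 1) * (real N - 1 + 1)))
      = 3 * (real N - 1) / (total_weight N * (real N + 1))"
    using N total_weight_pos[of N] by (simp add: tilt_def oblong_def divide_simps) algebra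
  moreover have "slope N k = 1 - fgm_theta k / weight N k + tilt N * cubic k / weight N k"
    by (simp add: slope_def diff_divide_distrib)
  ultimately show ?thesis unfolding slope_bound_def by linarith
qed

lemma total_weight_gt_1: "1 < total_weight N"
  by (simp add: total_weight_def field_simps)
    (smt (verit) of_nat_0_le_iff mult_nonneg_nonneg)

lemma end_slack_eq:
  assumes "0 < N"
  shows "end_slack N = total_weight N * (total_weight N - 1)\<^sup>2 / (total_weight N + 1)\<^sup>2"
  using total_weight_pos[of N] unfolding end_slack_def weight_end[OF assms]
  by (simp add: power_divide divide_simps) algebra

lemma end_slack_pos: "0 < N \<Longrightarrow> 0 < end_slack N"
  using total_weight_gt_1[of N] by (simp add: end_slack_eq)

lemma weight_end_ratio:
  assumes "0 < N"
  shows "(weight N N)\<^sup>2 / end_slack N = 4 * total_weight N / (total_weight N - 1)\<^sup>2"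
  using total_weight_gt_1[of N] unfolding end_slack_eq[OF assms] weight_end[OF assms]
  by (simp add: power_divide divide_simps power2_eq_square)

text \<open>
The bracket bounds the sum of \<open>w\<^sub>k\<^sup>2\<close> divided by the available diagonal coefficient, which is the
Cauchy--Schwarz constant between squared path length and diagonal. The factor \<open>1 / 4\<close> is one half from
centring the slopes times one half from the variation inequality. For large \<open>N\<close> the left side
tends to \<open>3 / 4\<close>.
\<close>

lemma slope_budget:
  assumes "0 < N"
  shows "slope_bound N / 4 * (real N * ((real N + 8) / (real N + 5))\<^sup>2
      + real N * ((weight N N)\<^sup>2 / end_slack N)) \<le> 1"
proof -
  define n m where "n = real N" and "m = n - 1"
  define T4 a where "T4 = (n + 2) * (n + 3)" and "a = T4 - 4"
  have m: "0 \<le> m" "n = 1 + m" using assms by (simp_all add: n_def m_def)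
  have n: "n > 0" using m by simp
  have T4: "total_weight N = T4 / 4" "T4 > 0" using n by (simp_all add: total_weight_def T4_def n_def)
  have a: "total_weight N - 1 = a / 4" "a > 0"
    using total_weight_gt_1[of N] by (simp_all add: T4 a_def field_simps)
  have bound: "slope_bound N = (3 * T4 * (n + 1) + 12 * (n - 1) * (n + 8)) / ((n + 8) * T4 * (n + 1))"
    using n T4(2) unfolding slope_bound_def n_def[symmetric] T4(1) by (simp add: divide_simps)
  have end_ratio: "(weight N N)\<^sup>2 / end_slack N = 16 * T4 / a\<^sup>2"
    unfolding weight_end_ratio[OF assms] a(1) unfolding T4(1) by (simp add: power_divide)
  have "4 * (n + 8) * T4 * (n + 1) * (n + 5)\<^sup>2 * a\<^sup>2
      - n * (3 * T4 * (n + 1) + 12 * (n - 1) * (n + 8)) * ((n + 8)\<^sup>2 * a\<^sup>2 + 16 * T4 * (n + 5)\<^sup>2) =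
      1119744 + 2211840 * m + 1503000 * m ^ 2 + 424590 * m ^ 3 + 40847 * m ^ 4
      + 18626 * m ^ 5 + 14243 * m ^ 6 + 4106 * m ^ 7 + 565 * m ^ 8 + 38 * m ^ 9 + m ^ 10"
    unfolding a_def T4_def m(2) by algebra
  also have "0 \<le> \<dots>"
    using m(1) by (intro add_nonneg_nonneg mult_nonneg_nonneg zero_le_power) simp_all
  finally have ineq: "n * (3 * T4 * (n + 1) + 12 * (n - 1) * (n + 8)) * ((n + 8)\<^sup>2 * a\<^sup>2 + 16 * T4 * (n + 5)\<^sup>2)
      \<le> 4 * (n + 8) * T4 * (n + 1) * (n + 5)\<^sup>2 * a\<^sup>2" by simp
  have "slope_bound N / 4 * (n * ((n + 8) / (n + 5))\<^sup>2 + n * ((weight N N)\<^sup>2 / end_slack N))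
      = n * (3 * T4 * (n + 1) + 12 * (n - 1) * (n + 8)) * ((n + 8)\<^sup>2 * a\<^sup>2 + 16 * T4 * (n + 5)\<^sup>2)
        / (4 * (n + 8) * T4 * (n + 1) * (n + 5)\<^sup>2 * a\<^sup>2)"
    using n T4(2) a(2) unfolding bound end_ratio by (simp add: power_divide divide_simps) algebra
  also have "\<dots> \<le> 1"
    using ineq n T4(2) a(2) by (subst divide_le_eq_1_pos) simp_all
  finally show ?thesis unfolding n_def .
qed

text \<open>
The discriminant condition for the part of the form that couples \<open>g\<^sub>N\<close> with \<open>\<Phi> = \<Sum>\<phi>\<^sub>j g\<^sub>j\<close>: with the tilted
coefficients \<open>b\<close>, the square \<open>\<bar>\<Phi>\<bar>\<^sup>2\<close> has the coefficient \<open>b\<^sub>N\<^sub>-\<^sub>1 / \<phi>\<^sub>N\<^sub>-\<^sub>1\<close> from the summation by parts.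
\<close>

lemma cross_budget:
  assumes "2 \<le> N"
  shows "cubic (N - 1) * (momentum N N + tilt N * weight N N)\<^sup>2
    \<le> (1 - 1 / real N) * end_slack N * (momentum N (N - 1) + tilt N * weight N (N - 1))"
proof -
  define n m where "n = real N" and "m = n - 2"
  define T M w q where "T = total_weight N" and "M = oblong N" and "w = weight N N" and "q = n\<^sup>2 + 7 * n + 14"
  define T4 a where "T4 = (n + 2) * (n + 3)" and "a = T4 - 4"
  have N: "0 < N" using assms by simp
  have m: "0 \<le> m" "n = 2 + m" using assms by (simp_all add: n_def m_def)
  have n: "n \<ge> 2" using m by simp
  have T4: "T = T4 / 4" "T4 > 0" using n by (simp_all add: T_def total_weight_def T4_def n_def)
  have M: "M > 0" using N by (simp add: M_def oblong_pos)
  have q: "q > 0" using n by (simp add: q_def add_pos_pos)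
  have T: "T \<ge> 3" using mult_mono[of 4 "n + 2" 5 "n + 3"] n by (simp add: T4 T4_def)
  have w: "w = 2 * T / (T + 1)" "w > 0" using weight_end[OF N] T by (simp_all add: w_def T_def)
  have k: "real (N - 1) = n - 1" using N by (simp add: n_def of_nat_diff)
  have cubic: "cubic (N - 1) = (n - 1) * M"
    unfolding cubic_def k by (simp add: M_def oblong_def n_def)
  have "a * a * (2 * T4 * T4 * (n + 2) + 3 * (n + 1) * (T4 + 4) * q) - 4 * T4 * T4 * n * (T4 + 4) * q =
      131072 + 508928 * m + 691712 * m ^ 2 + 478440 * m ^ 3 + 194475 * m ^ 4
      + 49369 * m ^ 5 + 7930 * m ^ 6 + 782 * m ^ 7 + 43 * m ^ 8 + m ^ 9"
    unfolding a_def T4_def q_def m(2) by algebra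
  also have "0 \<le> \<dots>"
    using m(1) by (intro add_nonneg_nonneg mult_nonneg_nonneg zero_le_power) simp_all
  finally have ineq: "4 * T4 * T4 * n * (T4 + 4) * q
      \<le> a * a * (2 * T4 * T4 * (n + 2) + 3 * (n + 1) * (T4 + 4) * q)" by simp
  have core: "T * n \<le> (T - 1)\<^sup>2 * (w * (n + 2) / q + 3 * (n + 1) / (4 * T))"
  proof -
    have rhs: "(T - 1)\<^sup>2 * (w * (n + 2) / q + 3 * (n + 1) / (4 * T))
        = a * a * (2 * T4 * T4 * (n + 2) + 3 * (n + 1) * (T4 + 4) * q) / (16 * T4 * (T4 + 4) * q)"
      using T4(2) q unfolding w(1) T4(1) a_def
      by (simp add: divide_simps power2_eq_square)
    have lhs: "T * n = 4 * T4 * T4 * n * (T4 + 4) * q / (16 * T4 * (T4 + 4) * q)"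
      using T4(2) q unfolding T4(1) by (simp add: divide_simps)
    show ?thesis
      unfolding rhs unfolding lhs using T4(2) q by (intro divide_right_mono ineq) simp
  qed
  \<comment> \<open>the second summand comes from the tilt and \<open>w\<^sub>k \<ge> \<theta>\<^sub>k\<close> at \<open>k = N - 1\<close>\<close>
  have last: "(w * (n + 2) / q + 3 * (n + 1) / (4 * T)) / M \<le> momentum N (N - 1) + tilt N * weight N (N - 1)"
  proof -
    have "3 / (2 * M * T) * ((n + 1) / 2) \<le> tilt N * weight N (N - 1)"
      using weight_ge[of "N - 1" N] N M T unfolding tilt_def M_def[symmetric] T_def[symmetric]
      by (intro mult_left_mono) (simp_all add: fgm_theta_def n_def)
    moreover have "momentum N (N - 1) = w * (n + 2) / (M * q)"
      using momentum_last[OF N] by (simp add: w_def n_def M_def q_def)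
    moreover have "(w * (n + 2) / q + 3 * (n + 1) / (4 * T)) / M
        = w * (n + 2) / (M * q) + 3 / (2 * M * T) * ((n + 1) / 2)"
      using M T q by (simp add: divide_simps)
    ultimately show ?thesis by simp
  qed
  have "momentum N N + tilt N * weight N N = - (1 - 3 / T) * (w / (2 * M))"
    using M T unfolding momentum_end[OF N] tilt_def w_def[symmetric] T_def[symmetric] M_def[symmetric]
    by (simp add: divide_simps) algebra
  then have "(momentum N N + tilt N * weight N N)\<^sup>2 = (1 - 3 / T)\<^sup>2 * (w / (2 * M))\<^sup>2"
    by (simp only: power_mult_distrib power2_minus)
  also have "\<dots> \<le> 1 * (w / (2 * M))\<^sup>2"
    using T by (intro mult_right_mono) (auto simp: power_le_one)
  finally have "cubic (N - 1) * (momentum N N + tilt N * weight N N)\<^sup>2 \<le> (n - 1) * M * (w / (2 * M))\<^sup>2"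
    unfolding cubic using n M by (simp add: mult_left_mono)
  also have "\<dots> = (1 - 1 / n) * (T / (T + 1)\<^sup>2) / M * (T * n)"
    using n M T unfolding w(1) by (simp add: divide_simps power2_eq_square)
  also have "\<dots> \<le> (1 - 1 / n) * (T / (T + 1)\<^sup>2) / M
      * ((T - 1)\<^sup>2 * (w * (n + 2) / q + 3 * (n + 1) / (4 * T)))"
    using core n M T by (intro mult_left_mono) auto
  also have "\<dots> = (1 - 1 / n) * end_slack N * ((w * (n + 2) / q + 3 * (n + 1) / (4 * T)) / M)"
    unfolding end_slack_eq[OF N] T_def[symmetric] by simp
  also have "\<dots> \<le> (1 - 1 / n) * end_slack N * (momentum N (N - 1) + tilt N * weight N (N - 1))"
    using last n end_slack_pos[OF N] by (intro mult_left_mono) auto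
  finally show ?thesis unfolding n_def .
qed

section \<open>The dual quadratic form\<close>

definition theta_sum :: "(nat \<Rightarrow> 'a::real_inner) \<Rightarrow> nat \<Rightarrow> 'a" where
  "theta_sum h k = (\<Sum>j<k. fgm_theta j *\<^sub>R h j)"

definition cubic_sum :: "(nat \<Rightarrow> 'a::real_inner) \<Rightarrow> nat \<Rightarrow> 'a" where
  "cubic_sum h k = (\<Sum>j<k. cubic j *\<^sub>R h j)"

definition weight_sum :: "nat \<Rightarrow> (nat \<Rightarrow> 'a::real_inner) \<Rightarrow> nat \<Rightarrow> 'a" where
  "weight_sum N h k = (\<Sum>j<k. weight N j *\<^sub>R h j)"

definition cross_term :: "nat \<Rightarrow> (nat \<Rightarrow> 'a::real_inner) \<Rightarrow> nat \<Rightarrow> 'a" where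
  "cross_term N h k = weight N k *\<^sub>R theta_sum h k + momentum N k *\<^sub>R cubic_sum h k"

text \<open>
The weighted sum of the interpolation inequalities bounds \<open>T * (f y\<^sub>N - f x\<^sub>\<star>)\<close> by a term linear in the
gradients minus half of this form.
\<close>

definition dual_form :: "nat \<Rightarrow> (nat \<Rightarrow> 'a::real_inner) \<Rightarrow> real" where
  "dual_form N h = (\<Sum>k<N. 2 * cum_weight N (Suc k) * (norm (h k))\<^sup>2) + total_weight N * (norm (h N))\<^sup>2
     + 2 * (\<Sum>k\<le>N. h k \<bullet> cross_term N h k)"

lemma cubic_pos: "0 < k \<Longrightarrow> 0 < cubic k"
  by (simp add: cubic_def)

text \<open>
Moves the partial summation from the step sizes to the weights, so that the condition \<open>V = 0\<close> can be used
at the upper end.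
\<close>

lemma abel_weight_sum:
  fixes h :: "nat \<Rightarrow> 'a::real_inner" and t :: real
  defines "\<Theta> \<equiv> \<lambda>k. theta_sum h k - t *\<^sub>R cubic_sum h k"
  shows "(\<Sum>k<n. weight N k * (h k \<bullet> \<Theta> k) + (fgm_theta k - t * cubic k) * (h k \<bullet> weight_sum N h (Suc k)))
    = weight_sum N h n \<bullet> \<Theta> n"
proof (induction n)
  case (Suc n)
  have \<Theta>_Suc: "\<Theta> (Suc n) = \<Theta> n + (fgm_theta n - t * cubic n) *\<^sub>R h n"
    by (simp add: \<Theta>_def theta_sum_def cubic_sum_def algebra_simps)
  have V_Suc: "weight_sum N h (Suc n) = weight_sum N h n + weight N n *\<^sub>R h n"
    by (simp add: weight_sum_def)
  show ?case
    unfolding sum.lessThan_Suc Suc \<Theta>_Suc V_Suc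
    by (simp add: inner_add_left inner_add_right inner_commute algebra_simps)
qed (simp add: weight_sum_def)

text \<open>
The two summations by parts. In the part with the step sizes, \<open>\<theta>\<^sub>k - t \<phi>\<^sub>k = (1 - slope\<^sub>k) w\<^sub>k\<close>, and
\<open>2 w\<^sub>k h\<^sub>k \<bullet> V\<^sub>k\<^sub>+\<^sub>1\<close> is the increment of \<open>\<bar>V\<bar>\<^sup>2\<close> plus \<open>w\<^sub>k\<^sup>2 \<bar>h\<^sub>k\<bar>\<^sup>2\<close>. The increments without the factor
\<open>slope\<close> telescope to \<open>\<bar>V\<^sub>N\<bar>\<^sup>2 = w\<^sub>N\<^sup>2 \<bar>h\<^sub>N\<bar>\<^sup>2\<close>.
\<close>

lemma dual_form_lower_bound:
  fixes h :: "nat \<Rightarrow> 'a::real_inner"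
  assumes N: "0 < N" and balanced: "weight_sum N h (Suc N) = 0"
  defines "V \<equiv> weight_sum N h"
  defines "b \<equiv> \<lambda>k. momentum N k + tilt N * weight N k"
  shows "(\<Sum>k<N. cum_weight N (Suc k) * (norm (h k))\<^sup>2) + end_slack N * (norm (h N))\<^sup>2
      + (\<Sum>k<N. slope N k * ((norm (V (Suc k)))\<^sup>2 - (norm (V k))\<^sup>2))
      + b (N - 1) / cubic (N - 1) * (norm (cubic_sum h N))\<^sup>2
      + 2 * b N * (h N \<bullet> cubic_sum h N) \<le> dual_form N h"
proof -
  define t where "t = tilt N"
  define \<Theta> where "\<Theta> k = theta_sum h k - t *\<^sub>R cubic_sum h k" for k
  define \<Delta> where "\<Delta> k = (norm (V (Suc k)))\<^sup>2 - (norm (V k))\<^sup>2" for k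
  have pair: "h k \<bullet> cross_term N h k = weight N k * (h k \<bullet> \<Theta> k) + b k * (h k \<bullet> cubic_sum h k)" for k
    by (simp add: cross_term_def \<Theta>_def b_def t_def inner_add_right inner_diff_right algebra_simps)
  have V_Suc: "V (Suc k) = V k + weight N k *\<^sub>R h k" for k
    by (simp add: V_def weight_sum_def)
  have weight_part: "(\<Sum>k\<le>N. weight N k * (h k \<bullet> \<Theta> k))
      = - (\<Sum>k<N. (fgm_theta k - t * cubic k) * (h k \<bullet> V (Suc k)))"
    using abel_weight_sum[of N h t "Suc N"] balanced
    by (simp add: \<Theta>_def V_def sum.distrib lessThan_Suc_atMost[symmetric])
  have node: "2 * ((fgm_theta k - t * cubic k) * (h k \<bullet> V (Suc k)))
      = \<Delta> k - slope N k * \<Delta> k + weight N k * (fgm_theta k - t * cubic k) * (norm (h k))\<^sup>2"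
    if "k < N" for k
  proof -
    have w: "0 < weight N k" by (rule weight_pos[OF that])
    have th: "fgm_theta k - t * cubic k = (1 - slope N k) * weight N k"
      using w by (simp add: slope_def t_def)
    have "2 * weight N k * (h k \<bullet> V (Suc k)) = \<Delta> k + (weight N k)\<^sup>2 * (norm (h k))\<^sup>2"
      unfolding \<Delta>_def V_Suc power2_norm_eq_inner
      by (simp add: inner_add_left inner_add_right inner_commute
          power2_eq_square algebra_simps)
    then have "(1 - slope N k) * (2 * weight N k * (h k \<bullet> V (Suc k)))
        = (1 - slope N k) * (\<Delta> k + (weight N k)\<^sup>2 * (norm (h k))\<^sup>2)" by simp
    then show ?thesis
      unfolding th by (simp add: power2_eq_square algebra_simps)
  qed
  have "sum \<Delta> {..<N} = (norm (V N))\<^sup>2"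
    unfolding \<Delta>_def by (subst sum_lessThan_telescope) (simp add: V_def weight_sum_def)
  also have "V N = - (weight N N *\<^sub>R h N)"
    using balanced V_Suc[of N] by (simp add: V_def eq_neg_iff_add_eq_0)
  finally have end_node: "sum \<Delta> {..<N} = (weight N N)\<^sup>2 * (norm (h N))\<^sup>2"
    by (simp add: power_mult_distrib)
  have cubic_part: "b (N - 1) / cubic (N - 1) * (norm (cubic_sum h N))\<^sup>2
      \<le> (\<Sum>k<N. 2 * b k * (h k \<bullet> cubic_sum h k) + cubic k * b k * (norm (h k))\<^sup>2)"
    unfolding cubic_sum_def
  proof (rule summation_by_parts_decreasing)
    show "cubic 0 = 0" by (simp add: cubic_def)
    show "cubic k * b (Suc k) \<le> cubic (Suc k) * b k" if k: "Suc k < N" for k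
    proof -
      have "(real k + 1) * (real k + 2) * (real k * weight N (Suc k))
          \<le> (real k + 1) * (real k + 2) * ((real k + 3) * weight N k)"
        by (intro mult_left_mono weight_growth k) simp
      then have "cubic k * weight N (Suc k) \<le> cubic (Suc k) * weight N k"
        by (simp add: cubic_def mult_ac add.commute)
      then have "tilt N * (cubic k * weight N (Suc k)) \<le> tilt N * (cubic (Suc k) * weight N k)"
        using tilt_pos[OF N] by (intro mult_left_mono) auto
      with momentum_decay[OF k] show ?thesis by (simp add: b_def algebra_simps)
    qed
  qed (rule cubic_pos)
  \<comment> \<open>both summations by parts leave diagonal terms; the tilt cancels from their sum\<close>
  have diag: "2 * cum_weight N (Suc k) - weight N k * (fgm_theta k - t * cubic k) - cubic k * b k = cum_weight N (Suc k)"
    if "k < N" for k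
  proof -
    have "cubic k * b k = cum_weight N k - real k * weight N k / 2 + t * (cubic k * weight N k)"
      using cubic_momentum[OF that] by (simp add: b_def t_def algebra_simps)
    then show ?thesis
      by (simp add: fgm_theta_def weight_def algebra_simps add_divide_distrib diff_divide_distrib)
  qed
  have "dual_form N h = (\<Sum>k<N. 2 * cum_weight N (Suc k) * (norm (h k))\<^sup>2) + total_weight N * (norm (h N))\<^sup>2
     + 2 * (\<Sum>k\<le>N. weight N k * (h k \<bullet> \<Theta> k)) + 2 * (\<Sum>k\<le>N. b k * (h k \<bullet> cubic_sum h k))"
    by (simp add: dual_form_def pair sum.distrib)
  also have "2 * (\<Sum>k\<le>N. weight N k * (h k \<bullet> \<Theta> k))
      = - (\<Sum>k<N. \<Delta> k - slope N k * \<Delta> k + weight N k * (fgm_theta k - t * cubic k) * (norm (h k))\<^sup>2)"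
    unfolding weight_part using node by (simp add: sum_distrib_left)
  also have "\<dots> = - (weight N N)\<^sup>2 * (norm (h N))\<^sup>2 + (\<Sum>k<N. slope N k * \<Delta> k)
      - (\<Sum>k<N. weight N k * (fgm_theta k - t * cubic k) * (norm (h k))\<^sup>2)"
    by (simp add: sum.distrib sum_subtractf end_node)
  also have "2 * (\<Sum>k\<le>N. b k * (h k \<bullet> cubic_sum h k))
      = 2 * b N * (h N \<bullet> cubic_sum h N)
        + (\<Sum>k<N. 2 * b k * (h k \<bullet> cubic_sum h k) + cubic k * b k * (norm (h k))\<^sup>2)
        - (\<Sum>k<N. cubic k * b k * (norm (h k))\<^sup>2)"
    by (simp add: lessThan_Suc_atMost[symmetric] sum.distrib sum_distrib_left algebra_simps)
  finally have expand: "dual_form N h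
      = (\<Sum>k<N. 2 * cum_weight N (Suc k) * (norm (h k))\<^sup>2)
        - (\<Sum>k<N. weight N k * (fgm_theta k - t * cubic k) * (norm (h k))\<^sup>2)
        - (\<Sum>k<N. cubic k * b k * (norm (h k))\<^sup>2)
        + end_slack N * (norm (h N))\<^sup>2 + (\<Sum>k<N. slope N k * \<Delta> k) + 2 * b N * (h N \<bullet> cubic_sum h N)
        + (\<Sum>k<N. 2 * b k * (h k \<bullet> cubic_sum h k) + cubic k * b k * (norm (h k))\<^sup>2)"
    by (simp add: end_slack_def algebra_simps)
  have "(\<Sum>k<N. 2 * cum_weight N (Suc k) * (norm (h k))\<^sup>2)
        - (\<Sum>k<N. weight N k * (fgm_theta k - t * cubic k) * (norm (h k))\<^sup>2)
        - (\<Sum>k<N. cubic k * b k * (norm (h k))\<^sup>2)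
      = (\<Sum>k<N. (2 * cum_weight N (Suc k) - weight N k * (fgm_theta k - t * cubic k) - cubic k * b k)
          * (norm (h k))\<^sup>2)"
    by (simp add: sum_subtractf left_diff_distrib)
  also have "\<dots> = (\<Sum>k<N. cum_weight N (Suc k) * (norm (h k))\<^sup>2)"
    by (rule sum.cong) (simp_all only: diag lessThan_iff)
  finally show ?thesis
    using expand cubic_part by (simp add: \<Delta>_def)
qed

text \<open>
The left side bounds what the slopes can cost: the increments of the path are \<open>w\<^sub>k h\<^sub>k\<close>, so the sum
is its length.
\<close>

lemma weighted_length_square:
  fixes h :: "nat \<Rightarrow> 'a::real_inner"
  assumes N: "0 < N"
  shows "slope_bound N / 4 * (\<Sum>k\<le>N. weight N k * norm (h k))\<^sup>2
    \<le> (\<Sum>k<N. cum_weight N (Suc k) * (norm (h k))\<^sup>2) + end_slack N / real N * (norm (h N))\<^sup>2"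
proof -
  \<comment> \<open>the diagonal coefficients that may be spent\<close>
  define s where "s k = (if k < N then cum_weight N (Suc k) else end_slack N / real N)" for k
  have s_pos: "0 < s k" for k
  proof (cases "k < N")
    case True
    then have "0 < real (Suc k) * (real (Suc k) + 3) / 4" by simp
    also have "\<dots> \<le> cum_weight N (Suc k)" using True by (intro cum_weight_ge) auto
    finally show ?thesis using True by (simp add: s_def)
  qed (use N end_slack_pos in \<open>simp add: s_def\<close>)
  have energy: "(\<Sum>k\<le>N. s k * (norm (h k))\<^sup>2)
      = (\<Sum>k<N. cum_weight N (Suc k) * (norm (h k))\<^sup>2) + end_slack N / real N * (norm (h N))\<^sup>2"
    by (simp add: lessThan_Suc_atMost[symmetric] s_def)
  then have energy_nonneg: "0 \<le> (\<Sum>k<N. cum_weight N (Suc k) * (norm (h k))\<^sup>2) + end_slack N / real N * (norm (h N))\<^sup>2"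
    using s_pos by (metis (no_types, lifting) sum_nonneg mult_nonneg_nonneg less_imp_le zero_le_power2)
  have cap: "(\<Sum>k\<le>N. (weight N k)\<^sup>2 / s k)
      \<le> real N * ((real N + 8) / (real N + 5))\<^sup>2 + real N * ((weight N N)\<^sup>2 / end_slack N)"
  proof -
    have "(weight N k)\<^sup>2 / s k \<le> ((real N + 8) / (real N + 5))\<^sup>2" if "k < N" for k
      using weight_square_le[OF that] s_pos[of k] that by (simp add: s_def pos_divide_le_eq)
    then have "(\<Sum>k<N. (weight N k)\<^sup>2 / s k) \<le> (\<Sum>k<N. ((real N + 8) / (real N + 5))\<^sup>2)"
      by (intro sum_mono) auto
    then show ?thesis
      by (simp add: lessThan_Suc_atMost[symmetric] s_def mult.commute)
  qed
  have "(\<Sum>k\<le>N. weight N k * norm (h k))\<^sup>2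
      = (\<Sum>k\<le>N. (weight N k / sqrt (s k)) * (sqrt (s k) * norm (h k)))\<^sup>2"
    using s_pos by (simp add: less_imp_neq[THEN not_sym])
  also have "\<dots> \<le> (\<Sum>k\<le>N. (weight N k / sqrt (s k))\<^sup>2) * (\<Sum>k\<le>N. (sqrt (s k) * norm (h k))\<^sup>2)"
    by (rule Cauchy_Schwarz_ineq_sum)
  also have "\<dots> = (\<Sum>k\<le>N. (weight N k)\<^sup>2 / s k) * (\<Sum>k\<le>N. s k * (norm (h k))\<^sup>2)"
    using s_pos by (simp add: power_divide power_mult_distrib less_imp_le)
  also have "\<dots> \<le> (real N * ((real N + 8) / (real N + 5))\<^sup>2 + real N * ((weight N N)\<^sup>2 / end_slack N))
      * (\<Sum>k\<le>N. s k * (norm (h k))\<^sup>2)"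
    using cap energy energy_nonneg by (intro mult_right_mono) auto
  finally have "slope_bound N / 4 * (\<Sum>k\<le>N. weight N k * norm (h k))\<^sup>2
      \<le> slope_bound N / 4 * ((real N * ((real N + 8) / (real N + 5))\<^sup>2 + real N * ((weight N N)\<^sup>2 / end_slack N))
      * (\<Sum>k\<le>N. s k * (norm (h k))\<^sup>2))"
    using slope_nonneg[OF N] slope_le[OF N] by (intro mult_left_mono) auto
  also have "\<dots> \<le> 1 * (\<Sum>k\<le>N. s k * (norm (h k))\<^sup>2)"
    using slope_budget[OF N] energy energy_nonneg unfolding mult.assoc[symmetric]
    by (intro mult_right_mono) auto
  finally show ?thesis using energy by simp
qed

text \<open>
The increments of \<open>\<bar>V\<bar>\<^sup>2\<close> over the closed path add up to zero, so any constant may be subtracted from the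
slopes. Subtracting half of their upper bound halves their modulus, which is decisive for
\<open>slope_budget\<close>.
\<close>

lemma dual_form_nonneg:
  fixes h :: "nat \<Rightarrow> 'a::real_inner"
  assumes N: "0 < N" and balanced: "weight_sum N h (Suc N) = 0"
  shows "0 \<le> dual_form N h"
proof -
  define V where "V = weight_sum N h"
  define b where "b k = momentum N k + tilt N * weight N k" for k
  define \<Delta> where "\<Delta> k = (norm (V (Suc k)))\<^sup>2 - (norm (V k))\<^sup>2" for k
  \<comment> \<open>the edge that closes the path gets slope \<open>0\<close>, which is within the bounds\<close>
  define \<rho> where "\<rho> k = (if k < N then slope N k else 0)" for k
  define c where "c = slope_bound N / 2"
  have V: "V 0 = 0" "V (Suc N) = 0" and V_Suc: "V (Suc k) - V k = weight N k *\<^sub>R h k" for k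
    using balanced by (simp_all add: V_def weight_sum_def)
  have weight_nonneg: "0 \<le> weight N k" if "k \<le> N" for k
    using that weight_pos[of k N] weight_end[OF N] total_weight_pos[of N] by (cases "k = N") auto
  have "(\<Sum>k<N. slope N k * \<Delta> k) = (\<Sum>k\<le>N. \<rho> k * \<Delta> k)"
    by (simp add: \<rho>_def lessThan_Suc_atMost[symmetric])
  also have "\<dots> = (\<Sum>k\<le>N. (\<rho> k - c) * \<Delta> k)"
  proof -
    have "sum \<Delta> {..N} = 0"
      unfolding \<Delta>_def lessThan_Suc_atMost[symmetric] by (subst sum_lessThan_telescope) (simp add: V)
    then show ?thesis
      by (simp add: left_diff_distrib sum_subtractf flip: sum_distrib_left)
  qed
  also have "\<dots> \<ge> (\<Sum>k\<le>N. - (c * \<bar>\<Delta> k\<bar>))"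
  proof (rule sum_mono)
    fix k assume "k \<in> {..N}"
    have "0 \<le> \<rho> k" "\<rho> k \<le> 2 * c"
      using slope_nonneg[of k N] slope_le[of k N] slope_nonneg[OF N] slope_le[OF N]
      by (auto simp: \<rho>_def c_def)
    then have "\<bar>\<rho> k - c\<bar> \<le> c" by linarith
    then have "\<bar>(\<rho> k - c) * \<Delta> k\<bar> \<le> c * \<bar>\<Delta> k\<bar>"
      by (simp add: abs_mult mult_right_mono)
    then show "- (c * \<bar>\<Delta> k\<bar>) \<le> (\<rho> k - c) * \<Delta> k" by linarith
  qed
  finally have "- (c * (\<Sum>k\<le>N. \<bar>\<Delta> k\<bar>)) \<le> (\<Sum>k<N. slope N k * \<Delta> k)"
    by (simp add: sum_negf sum_distrib_left)
  moreover have "(\<Sum>k\<le>N. \<bar>\<Delta> k\<bar>) \<le> (\<Sum>k\<le>N. weight N k * norm (h k))\<^sup>2 / 2"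
    using total_variation_square_norm[OF V] weight_nonneg
    by (simp add: \<Delta>_def V_Suc lessThan_Suc_atMost)
  then have "c * (\<Sum>k\<le>N. \<bar>\<Delta> k\<bar>) \<le> c * ((\<Sum>k\<le>N. weight N k * norm (h k))\<^sup>2 / 2)"
    using slope_nonneg[OF N] slope_le[OF N] by (intro mult_left_mono) (auto simp: c_def)
  ultimately have slopes: "- ((\<Sum>k<N. cum_weight N (Suc k) * (norm (h k))\<^sup>2) + end_slack N / real N * (norm (h N))\<^sup>2)
      \<le> (\<Sum>k<N. slope N k * \<Delta> k)"
    using weighted_length_square[OF N, of h] by (simp add: c_def)
  have cross: "0 \<le> b (N - 1) / cubic (N - 1) * (norm (cubic_sum h N))\<^sup>2
      + 2 * b N * (h N \<bullet> cubic_sum h N) + (1 - 1 / real N) * end_slack N * (norm (h N))\<^sup>2"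
  proof (cases "N = 1")
    case True
    then show ?thesis by (simp add: cubic_sum_def cubic_def)
  next
    case False
    then have N2: "2 \<le> N" using N by simp
    have "0 < cubic (N - 1)" using N2 by (simp add: cubic_pos)
    moreover have "0 \<le> b (N - 1)"
      using N momentum_nonneg[of "N - 1" N] weight_pos[of "N - 1" N] tilt_pos[OF N] by (simp add: b_def)
    ultimately show ?thesis
      using cross_budget[OF N2] N2 end_slack_pos[OF N]
      by (intro quadratic_nonneg) (simp_all add: b_def field_simps)
  qed
  have "end_slack N * (norm (h N))\<^sup>2
      = end_slack N / real N * (norm (h N))\<^sup>2 + (1 - 1 / real N) * end_slack N * (norm (h N))\<^sup>2"
    using N by (simp add: field_simps)
  then show ?thesis
    using dual_form_lower_bound[OF N balanced] slopes cross
    unfolding V_def[symmetric] b_def[symmetric] \<Delta>_def[symmetric] by linarith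
qed

section \<open>Constant gradients\<close>

lemma sum_theta: "(\<Sum>j<k. fgm_theta j) = real k * (real k + 3) / 4"
  by (induction k) (auto simp: fgm_theta_def field_simps)

lemma sum_cubic: "(\<Sum>j<k. cubic j) = (real k - 1) * real k * (real k + 1) * (real k + 2) / 4"
  by (induction k) (auto simp: cubic_def field_simps)

lemma sum_weight: "(\<Sum>j<k. weight N j) = cum_weight N k"
  unfolding weight_def by (subst sum_lessThan_telescope) simp

text \<open>
The cross terms containing \<open>h\<^sub>k\<close>, plus what \<open>h\<^sub>k\<close> contributes to all of them together after the order
of summation is reversed: \<open>h\<^sub>k\<close> multiplies \<open>\<theta>\<^sub>j\<close> and \<open>\<phi>\<^sub>j\<close> for all \<open>j < k\<close>. Summed over \<open>k\<close> this is the
pairing of the symmetrized cross part with a constant sequence.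
\<close>

definition sym_row :: "nat \<Rightarrow> (nat \<Rightarrow> 'a::real_inner) \<Rightarrow> nat \<Rightarrow> 'a" where
  "sym_row N h k = cross_term N h k + (weight N k * (\<Sum>j<k. fgm_theta j) + momentum N k * (\<Sum>j<k. cubic j)) *\<^sub>R h k"

text \<open>
Running form of the row identities. The last two terms account for the pairs \<open>(j, k)\<close> with
\<open>j < n \<le> k\<close>: the weights from index \<open>n\<close> on add up to \<open>T - W\<^sub>n\<^sub>-\<^sub>1\<close>, and the coefficients \<open>b\<^sub>k\<close> telescope.
\<close>

lemma row_sum_prefix:
  fixes h :: "nat \<Rightarrow> 'a::real_inner"
  assumes "n \<le> N"
  shows "(\<Sum>k<n. (2 * cum_weight N (Suc k)) *\<^sub>R h k + sym_row N h k)
    = total_weight N *\<^sub>R weight_sum N h n - (total_weight N - cum_weight N n) *\<^sub>R theta_sum h n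
      - ((weight_ratio N n - total_weight N / oblong N) / 2) *\<^sub>R cubic_sum h n"
  using assms
proof (induction n)
  case (Suc n)
  define r where "r k = (weight_ratio N k - total_weight N / oblong N) / 2" for k
  have rm: "r n = momentum N n + r (Suc n)" by (simp add: r_def momentum_def field_simps)
  have cw: "cum_weight N n = cum_weight N (Suc n) - weight N n" by (simp add: weight_def)
  have coef: "2 * cum_weight N (Suc n) + (weight N n * (\<Sum>j<n. fgm_theta j) + momentum N n * (\<Sum>j<n. cubic j))
      = total_weight N * weight N n - (total_weight N - cum_weight N (Suc n)) * fgm_theta n - r (Suc n) * cubic n"
    using row_identity[of n N] Suc.prems unfolding sum_theta sum_cubic r_def by (simp add: algebra_simps)
  have "(2 * cum_weight N (Suc n)) *\<^sub>R h n + sym_row N h n = cross_term N h n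
      + (2 * cum_weight N (Suc n) + (weight N n * (\<Sum>j<n. fgm_theta j) + momentum N n * (\<Sum>j<n. cubic j))) *\<^sub>R h n"
    by (simp add: sym_row_def scaleR_add_left)
  also have "\<dots> = cross_term N h n
      + (total_weight N * weight N n - (total_weight N - cum_weight N (Suc n)) * fgm_theta n - r (Suc n) * cubic n) *\<^sub>R h n"
    by (simp only: coef)
  finally have step: "(2 * cum_weight N (Suc n)) *\<^sub>R h n + sym_row N h n = cross_term N h n
      + (total_weight N * weight N n - (total_weight N - cum_weight N (Suc n)) * fgm_theta n - r (Suc n) * cubic n) *\<^sub>R h n" .
  show ?case
    unfolding sum.lessThan_Suc step Suc.IH[OF Suc_leD[OF Suc.prems]] r_def[symmetric] rm cw
    by (simp add: cross_term_def theta_sum_def cubic_sum_def weight_sum_def algebra_simps)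
qed (simp add: weight_sum_def theta_sum_def cubic_sum_def)

lemma row_sum:
  fixes h :: "nat \<Rightarrow> 'a::real_inner"
  assumes N: "0 < N"
  shows "(\<Sum>k<N. (2 * cum_weight N (Suc k)) *\<^sub>R h k) + total_weight N *\<^sub>R h N + (\<Sum>k\<le>N. sym_row N h k)
    = total_weight N *\<^sub>R weight_sum N h (Suc N)"
proof -
  have coef: "total_weight N + (weight N N * (\<Sum>j<N. fgm_theta j) + momentum N N * (\<Sum>j<N. cubic j))
      = total_weight N * weight N N"
    using row_identity_end[OF N] by (simp add: sum_theta sum_cubic)
  have "sym_row N h N + total_weight N *\<^sub>R h N = cross_term N h N
      + (total_weight N + (weight N N * (\<Sum>j<N. fgm_theta j) + momentum N N * (\<Sum>j<N. cubic j))) *\<^sub>R h N"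
    by (simp add: sym_row_def scaleR_add_left)
  also have "\<dots> = cross_term N h N + (total_weight N * weight N N) *\<^sub>R h N"
    by (simp only: coef)
  finally have last: "sym_row N h N + total_weight N *\<^sub>R h N = cross_term N h N + (total_weight N * weight N N) *\<^sub>R h N" .
  have momentum: "momentum N N = (weight_ratio N N - total_weight N / oblong N) / 2"
    by (simp add: momentum_def weight_ratio_def)
  have weight: "weight N N = total_weight N - cum_weight N N" by (simp add: weight_def)
  have "(\<Sum>k<N. (2 * cum_weight N (Suc k)) *\<^sub>R h k) + total_weight N *\<^sub>R h N + (\<Sum>k\<le>N. sym_row N h k)
      = (\<Sum>k<N. (2 * cum_weight N (Suc k)) *\<^sub>R h k + sym_row N h k) + (sym_row N h N + total_weight N *\<^sub>R h N)"
    by (simp add: sum.distrib lessThan_Suc_atMost[symmetric] add_ac)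
  also have "\<dots> = total_weight N *\<^sub>R weight_sum N h N + (total_weight N * weight N N) *\<^sub>R h N"
    unfolding row_sum_prefix[OF order_refl] last cross_term_def
    unfolding momentum[symmetric] weight[symmetric] by simp
  finally show ?thesis by (simp add: weight_sum_def scaleR_add_right)
qed

text \<open>
On sequences with \<open>V = 0\<close>, constants are orthogonal to everything by \<open>row_sum\<close>, and on constants the
form equals \<open>\<bar>V\<bar>\<^sup>2\<close>.
\<close>

lemma dual_form_shift:
  fixes h :: "nat \<Rightarrow> 'a::real_inner"
  assumes N: "0 < N" and balanced: "weight_sum N h (Suc N) = 0"
  shows "dual_form N (\<lambda>k. h k + a) = dual_form N h + (total_weight N)\<^sup>2 * (norm a)\<^sup>2"
proof -
  define e where "e k = weight N k * (\<Sum>j<k. fgm_theta j) + momentum N k * (\<Sum>j<k. cubic j)" for k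
  have pair: "cross_term N (\<lambda>k. h k + a) k = cross_term N h k + e k *\<^sub>R a" for k
    by (simp add: cross_term_def theta_sum_def cubic_sum_def e_def scaleR_add_right sum.distrib
        scaleR_sum_left[symmetric] algebra_simps)
  have row: "sym_row N h k = cross_term N h k + e k *\<^sub>R h k" for k
    by (simp add: sym_row_def e_def)
  have terms: "(h k + a) \<bullet> cross_term N (\<lambda>k. h k + a) k
      = h k \<bullet> cross_term N h k + a \<bullet> sym_row N h k + e k * (norm a)\<^sup>2" for k
    unfolding pair row
    by (simp add: inner_add_left inner_add_right power2_norm_eq_inner inner_commute algebra_simps)
  have sq: "(norm (u + a))\<^sup>2 = (norm u)\<^sup>2 + 2 * (a \<bullet> u) + (norm a)\<^sup>2" for u
    by (simp add: power2_norm_eq_inner inner_add_left inner_add_right inner_commute)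
  have linear: "(\<Sum>k<N. 2 * cum_weight N (Suc k) * (a \<bullet> h k)) + total_weight N * (a \<bullet> h N) + (\<Sum>k\<le>N. a \<bullet> sym_row N h k) = 0"
    using arg_cong[OF row_sum[OF N, of h], of "\<lambda>v. a \<bullet> v"] balanced
    by (simp add: inner_add_right inner_sum_right)
  \<comment> \<open>the row sums once more, for the constant real sequence \<open>1\<close>\<close>
  have ones: "(\<Sum>k<N. 2 * cum_weight N (Suc k)) + total_weight N + 2 * (\<Sum>k\<le>N. e k) = (total_weight N)\<^sup>2"
  proof -
    have "sym_row N (\<lambda>_. 1::real) k = 2 * e k" for k
      by (simp add: sym_row_def e_def cross_term_def theta_sum_def cubic_sum_def)
    moreover have "weight_sum N (\<lambda>_. 1::real) (Suc N) = total_weight N"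
      using sum_weight[of N "Suc N"] by (simp add: weight_sum_def)
    ultimately show ?thesis
      using row_sum[OF N, of "\<lambda>_. 1::real"] by (simp add: sum_distrib_left power2_eq_square)
  qed
  have "dual_form N (\<lambda>k. h k + a) = dual_form N h
      + 2 * ((\<Sum>k<N. 2 * cum_weight N (Suc k) * (a \<bullet> h k)) + total_weight N * (a \<bullet> h N) + (\<Sum>k\<le>N. a \<bullet> sym_row N h k))
      + ((\<Sum>k<N. 2 * cum_weight N (Suc k)) + total_weight N + 2 * (\<Sum>k\<le>N. e k)) * (norm a)\<^sup>2"
    unfolding dual_form_def terms sq
    by (simp add: sum.distrib sum_distrib_left sum_distrib_right algebra_simps)
  then show ?thesis by (simp add: linear ones)
qed

text \<open>
The mean \<open>V / T\<close> is subtracted from all gradients, which makes the weighted sum vanish.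
\<close>

lemma dual_form_ge:
  fixes g :: "nat \<Rightarrow> 'a::real_inner"
  assumes N: "0 < N"
  shows "(norm (weight_sum N g (Suc N)))\<^sup>2 \<le> dual_form N g"
proof -
  define a where "a = (1 / total_weight N) *\<^sub>R weight_sum N g (Suc N)"
  define h where "h k = g k - a" for k
  have V: "weight_sum N g (Suc N) = total_weight N *\<^sub>R a"
    using total_weight_pos[of N] by (simp add: a_def)
  have "weight_sum N h (Suc N) = weight_sum N g (Suc N) - (\<Sum>j<Suc N. weight N j) *\<^sub>R a"
    unfolding weight_sum_def h_def by (simp add: scaleR_diff_right sum_subtractf scaleR_sum_left del: sum.lessThan_Suc)
  then have balanced: "weight_sum N h (Suc N) = 0"
    unfolding sum_weight V by simp
  have "dual_form N g = dual_form N h + (total_weight N)\<^sup>2 * (norm a)\<^sup>2"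
    using dual_form_shift[OF N balanced, of a] by (simp add: h_def)
  also have "\<dots> \<ge> (total_weight N)\<^sup>2 * (norm a)\<^sup>2"
    using dual_form_nonneg[OF N balanced] by simp
  finally show ?thesis unfolding V by (simp add: power_mult_distrib)
qed

section \<open>The certificate applied to the iteration\<close>

text \<open>
The iterates in terms of the gradients. The coefficient of \<open>\<Sum>\<phi>\<^sub>j g\<^sub>j\<close> is inherited from \<open>x\<^sub>k\<close> by \<open>y\<^sub>k\<^sub>+\<^sub>1\<close>,
because \<open>\<phi>\<^sub>k / (2 (k + 1) (k + 2)) = \<theta>\<^sub>k - 1\<close> accounts for the difference between the steps of \<open>z\<close>
and \<open>y\<close>; averaging with \<open>z\<^sub>k\<^sub>+\<^sub>1\<close> damps it to the next value. For \<open>y\<^sub>0\<close> the coefficient is the quotient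
\<open>1 / 0\<close>, and it multiplies an empty sum.
\<close>

lemma fgm_positions:
  fixes x y z g :: "nat \<Rightarrow> 'a::real_inner"
  assumes init: "y 0 = x 0" "z 0 = x 0"
    and y_step: "\<And>k. k < N \<Longrightarrow> y (Suc k) = x k - g k"
    and z_step: "\<And>k. k < N \<Longrightarrow> z (Suc k) = z k - fgm_theta k *\<^sub>R g k"
    and x_step: "\<And>k. k < N \<Longrightarrow> x (Suc k) =
      (1 - 1 / fgm_theta (Suc k)) *\<^sub>R y (Suc k) + (1 / fgm_theta (Suc k)) *\<^sub>R z (Suc k)"
    and "k \<le> N"
  shows "x k = x 0 - theta_sum g k + (1 / (2 * ((real k + 1) * (real k + 2)))) *\<^sub>R cubic_sum g k
    \<and> y k = x 0 - theta_sum g k + (1 / (2 * (real k * (real k + 1)))) *\<^sub>R cubic_sum g k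
    \<and> z k = x 0 - theta_sum g k"
  using \<open>k \<le> N\<close>
proof (induction k)
  case 0
  show ?case by (simp add: init theta_sum_def cubic_sum_def)
next
  case (Suc k)
  define r where "r = real k"
  define u where "u = 1 / (2 * ((r + 1) * (r + 2)))"
  define v where "v = 1 / (2 * ((r + 2) * (r + 3)))"
  have r: "r \<ge> 0" by (simp add: r_def)
  have k: "k < N" "k \<le> N" using Suc.prems by auto
  have S: "real (Suc k) = r + 1" "r + 1 + 1 = r + 2" "r + 1 + 2 = r + 3" by (simp_all add: r_def)
  have uc: "u * cubic k = fgm_theta k - 1"
    using r by (simp add: u_def cubic_def fgm_theta_def r_def[symmetric] divide_simps)
  have uv: "(1 - 1 / fgm_theta (Suc k)) * u = v"
    using r unfolding fgm_theta_def S u_def v_def by (simp add: divide_simps)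
  have xk: "x k = x 0 - theta_sum g k + u *\<^sub>R cubic_sum g k"
    using Suc.IH[OF k(2)] by (simp add: u_def r_def)
  have z': "z (Suc k) = x 0 - theta_sum g (Suc k)"
    using z_step[OF k(1)] Suc.IH[OF k(2)] by (simp add: theta_sum_def)
  have "y (Suc k) = x 0 - theta_sum g k + u *\<^sub>R cubic_sum g k - g k"
    using y_step[OF k(1)] xk by simp
  also have "\<dots> = x 0 - theta_sum g (Suc k) + u *\<^sub>R cubic_sum g (Suc k)"
  proof -
    have "u *\<^sub>R cubic_sum g (Suc k) = u *\<^sub>R cubic_sum g k + (fgm_theta k - 1) *\<^sub>R g k"
      by (simp add: cubic_sum_def scaleR_add_right flip: uc)
    then show ?thesis by (simp add: theta_sum_def algebra_simps)
  qed
  finally have y': "y (Suc k) = x 0 - theta_sum g (Suc k) + u *\<^sub>R cubic_sum g (Suc k)" .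
  have "x (Suc k) = x 0 - theta_sum g (Suc k)
      + ((1 - 1 / fgm_theta (Suc k)) * u) *\<^sub>R cubic_sum g (Suc k)"
    unfolding x_step[OF k(1)] y' z' by (simp add: algebra_simps)
  then have "x (Suc k) = x 0 - theta_sum g (Suc k) + v *\<^sub>R cubic_sum g (Suc k)"
    by (simp only: uv)
  with y' z' show ?case
    unfolding S u_def v_def by simp
qed

text \<open>
Links the iteration to the quadratic form. The first summand comes from the comparison with the
minimizer, the second from the comparison with the previous point, whose gradient step ends in \<open>y\<^sub>k\<close>.
\<close>

lemma fgm_cross_term:
  fixes x y z g :: "nat \<Rightarrow> 'a::real_inner"
  assumes init: "y 0 = x 0" "z 0 = x 0"
    and y_step: "\<And>k. k < N \<Longrightarrow> y (Suc k) = x k - g k"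
    and z_step: "\<And>k. k < N \<Longrightarrow> z (Suc k) = z k - fgm_theta k *\<^sub>R g k"
    and x_step: "\<And>k. k < N \<Longrightarrow> x (Suc k) =
      (1 - 1 / fgm_theta (Suc k)) *\<^sub>R y (Suc k) + (1 / fgm_theta (Suc k)) *\<^sub>R z (Suc k)"
    and k: "k \<le> N" and N: "0 < N"
  defines "X \<equiv> \<lambda>k. if k < N then x k else y N"
  shows "weight N k *\<^sub>R (x 0 - X k) + cum_weight N k *\<^sub>R (y k - X k) = cross_term N g k"
proof -
  note pos = fgm_positions[of y x z N g, OF init y_step z_step x_step]
  note pos_x = pos[THEN conjunct1] and pos_y = pos[THEN conjunct2, THEN conjunct1]
  consider "k = 0" | "k = N" | "0 < k" "k < N" using k by linarith
  then show ?thesis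
  proof cases
    case 1
    then show ?thesis using N by (simp add: X_def init cross_term_def theta_sum_def cubic_sum_def)
  next
    case 2
    have y: "x 0 - y N = theta_sum g N - (1 / (2 * oblong N)) *\<^sub>R cubic_sum g N"
      using pos_y[of N] by (simp add: oblong_def)
    show ?thesis
      using 2 by (simp add: X_def y cross_term_def momentum_end[OF N] scaleR_diff_right)
  next
    case 3
    define r where "r = real k"
    have r: "r > 0" using 3 by (simp add: r_def)
    define u where "u = 1 / (2 * (r * (r + 1)))"
    define v where "v = 1 / (2 * ((r + 1) * (r + 2)))"
    have x: "x 0 - x k = theta_sum g k - v *\<^sub>R cubic_sum g k"
      using pos_x[of k] 3 by (simp add: v_def r_def)
    have yx: "y k - x k = (u - v) *\<^sub>R cubic_sum g k"
      using pos_x[of k] pos_y[of k] 3 by (simp add: u_def v_def r_def scaleR_diff_left)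
    have cubic: "cubic k = r * (r + 1) * (r + 2)" by (simp add: cubic_def r_def)
    have "cubic k * momentum N k = cum_weight N k - r * weight N k / 2"
      using cubic_momentum[OF 3(2)] by (simp add: r_def)
    then have "momentum N k = (cum_weight N k - r * weight N k / 2) / (r * (r + 1) * (r + 2))"
      using r cubic_pos[OF 3(1)] unfolding cubic by (simp only: eq_divide_eq mult.commute) simp
    also have "\<dots> = cum_weight N k * (u - v) - weight N k * v"
      using r unfolding u_def v_def by (simp add: divide_simps) algebra
    finally have momentum: "momentum N k = cum_weight N k * (u - v) - weight N k * v" .
    show ?thesis
      using 3 by (simp add: X_def x yx cross_term_def momentum algebra_simps)
  qed
qed

text \<open>
Since \<open>y\<^sub>k\<^sub>+\<^sub>1 = X\<^sub>k - G\<^sub>k\<close>, expanding the square in \<open>chain\<close> turns \<open>X\<^sub>k\<close> into \<open>y\<^sub>k\<^sub>+\<^sub>1\<close> and leaves two pure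
squares. The induction step adds \<open>chain\<close> with weight \<open>W\<^sub>k\<close> and \<open>star\<close> with weight \<open>w\<^sub>k\<^sub>+\<^sub>1\<close>.
\<close>

lemma weighted_interpolation:
  fixes X y G :: "nat \<Rightarrow> 'a::real_inner" and F :: "nat \<Rightarrow> real"
  assumes N: "0 < N"
    and step: "\<And>k. k < N \<Longrightarrow> y (Suc k) = X k - G k"
    and star: "\<And>k. k \<le> N \<Longrightarrow> F k + G k \<bullet> (xs - X k) + (norm (G k))\<^sup>2 / 2 \<le> Fs"
    and chain: "\<And>k. k < N \<Longrightarrow> F (Suc k) + G (Suc k) \<bullet> (X k - X (Suc k)) + (norm (G k - G (Suc k)))\<^sup>2 / 2 \<le> F k"
    and "k \<le> N"
  shows "cum_weight N (Suc k) * (F k - Fs)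
    \<le> (\<Sum>j\<le>k. G j \<bullet> (weight N j *\<^sub>R (X j - xs) - cum_weight N j *\<^sub>R (y j - X j)))
      - (\<Sum>j<k. cum_weight N (Suc j) * (norm (G j))\<^sup>2) - cum_weight N (Suc k) * (norm (G k))\<^sup>2 / 2"
  using \<open>k \<le> N\<close>
proof (induction k)
  case 0
  have "weight N 0 * (F 0 - Fs) \<le> weight N 0 * (G 0 \<bullet> (X 0 - xs) - (norm (G 0))\<^sup>2 / 2)"
    using star[of 0] weight_pos[OF N] by (intro mult_left_mono) (auto simp: inner_diff_right)
  then show ?case by (simp add: weight_def algebra_simps)
next
  case (Suc k)
  then have k: "k < N" by simp
  have weight_nonneg: "0 \<le> weight N (Suc k)"
    using k weight_pos[of "Suc k" N] weight_end[OF N] total_weight_pos[of N] by (cases "Suc k = N") auto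
  have cum_nonneg: "0 \<le> cum_weight N (Suc k)"
  proof -
    have "0 \<le> real (Suc k) * (real (Suc k) + 3) / 4" by simp
    also have "\<dots> \<le> cum_weight N (Suc k)" using k by (intro cum_weight_ge) auto
    finally show ?thesis .
  qed
  have "F (Suc k) + G (Suc k) \<bullet> (y (Suc k) - X (Suc k)) + (norm (G k))\<^sup>2 / 2 + (norm (G (Suc k)))\<^sup>2 / 2 \<le> F k"
    using chain[OF k] unfolding step[OF k] power2_norm_eq_inner
    by (simp add: inner_diff_left inner_diff_right inner_add_right inner_commute field_simps)
  then have "cum_weight N (Suc k) * (F (Suc k) - Fs) \<le> cum_weight N (Suc k) * (F k - Fs
      - G (Suc k) \<bullet> (y (Suc k) - X (Suc k)) - (norm (G k))\<^sup>2 / 2 - (norm (G (Suc k)))\<^sup>2 / 2)"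
    using cum_nonneg by (intro mult_left_mono) auto
  moreover have "weight N (Suc k) * (F (Suc k) - Fs)
      \<le> weight N (Suc k) * (G (Suc k) \<bullet> (X (Suc k) - xs) - (norm (G (Suc k)))\<^sup>2 / 2)"
    using star[of "Suc k"] Suc.prems weight_nonneg by (intro mult_left_mono) (auto simp: inner_diff_right)
  moreover have c: "cum_weight N (Suc (Suc k)) = cum_weight N (Suc k) + weight N (Suc k)"
    by (simp add: weight_def)
  ultimately show ?case
    using Suc.IH k unfolding c
    by (simp add: inner_diff_right algebra_simps add_divide_distrib)
qed

text \<open>
The rate for \<open>L = 1\<close>, as a statement about finitely many points, values and gradients that satisfy
the two families of interpolation inequalities.
\<close>

lemma fgm_normalized_bound:
  fixes x y z g :: "nat \<Rightarrow> 'a::real_inner" and F :: "nat \<Rightarrow> real"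
  assumes N: "0 < N"
    and init: "y 0 = x 0" "z 0 = x 0"
    and y_step: "\<And>k. k < N \<Longrightarrow> y (Suc k) = x k - g k"
    and z_step: "\<And>k. k < N \<Longrightarrow> z (Suc k) = z k - fgm_theta k *\<^sub>R g k"
    and x_step: "\<And>k. k < N \<Longrightarrow> x (Suc k) =
      (1 - 1 / fgm_theta (Suc k)) *\<^sub>R y (Suc k) + (1 / fgm_theta (Suc k)) *\<^sub>R z (Suc k)"
  defines "X \<equiv> \<lambda>k. if k < N then x k else y N"
  assumes star: "\<And>k. k \<le> N \<Longrightarrow> F k + g k \<bullet> (xs - X k) + (norm (g k))\<^sup>2 / 2 \<le> Fs"
    and chain: "\<And>k. k < N \<Longrightarrow> F (Suc k) + g (Suc k) \<bullet> (X k - X (Suc k)) + (norm (g k - g (Suc k)))\<^sup>2 / 2 \<le> F k"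
  shows "total_weight N * (F N - Fs) \<le> (norm (x 0 - xs))\<^sup>2 / 2"
proof -
  define V where "V = weight_sum N g (Suc N)"
  have split: "g j \<bullet> (weight N j *\<^sub>R (X j - xs) - cum_weight N j *\<^sub>R (y j - X j))
      = weight N j * (g j \<bullet> (x 0 - xs)) - g j \<bullet> cross_term N g j" if "j \<le> N" for j
  proof -
    have "weight N j *\<^sub>R (x 0 - X j) + cum_weight N j *\<^sub>R (y j - X j) = cross_term N g j"
      unfolding X_def by (rule fgm_cross_term[OF init y_step z_step x_step that N])
    then have "g j \<bullet> cross_term N g j = weight N j * (g j \<bullet> (x 0 - X j)) + cum_weight N j * (g j \<bullet> (y j - X j))"
      by (metis inner_add_right inner_scaleR_right)
    then show ?thesis
      by (simp add: inner_diff_right algebra_simps)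
  qed
  have "total_weight N * (F N - Fs)
    \<le> (\<Sum>j\<le>N. g j \<bullet> (weight N j *\<^sub>R (X j - xs) - cum_weight N j *\<^sub>R (y j - X j)))
      - (\<Sum>j<N. cum_weight N (Suc j) * (norm (g j))\<^sup>2) - total_weight N * (norm (g N))\<^sup>2 / 2"
    using weighted_interpolation[of N y X g F xs Fs N] N star chain y_step by (simp add: X_def)
  also have "(\<Sum>j\<le>N. g j \<bullet> (weight N j *\<^sub>R (X j - xs) - cum_weight N j *\<^sub>R (y j - X j)))
      = V \<bullet> (x 0 - xs) - (\<Sum>j\<le>N. g j \<bullet> cross_term N g j)"
    using split by (simp add: V_def weight_sum_def inner_sum_left sum_subtractf lessThan_Suc_atMost)
  also have "V \<bullet> (x 0 - xs) - (\<Sum>j\<le>N. g j \<bullet> cross_term N g j)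
      - (\<Sum>j<N. cum_weight N (Suc j) * (norm (g j))\<^sup>2) - total_weight N * (norm (g N))\<^sup>2 / 2
      = V \<bullet> (x 0 - xs) - dual_form N g / 2"
    by (simp add: dual_form_def sum_distrib_left[symmetric] mult.assoc field_simps)
  also have "\<dots> \<le> V \<bullet> (x 0 - xs) - (norm V)\<^sup>2 / 2"
    using dual_form_ge[OF N, of g] by (simp add: V_def)
  also have "\<dots> \<le> (norm (x 0 - xs))\<^sup>2 / 2"
  proof -
    have "0 \<le> (norm (V - (x 0 - xs)))\<^sup>2" by simp
    also have "\<dots> = (norm V)\<^sup>2 - 2 * (V \<bullet> (x 0 - xs)) + (norm (x 0 - xs))\<^sup>2"
      unfolding power2_norm_eq_inner inner_diff_left[of V "x 0 - xs"] inner_diff_right[of _ V "x 0 - xs"]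
      by (simp add: inner_commute)
    finally show ?thesis by simp
  qed
  finally show ?thesis .
qed

theorem theorem5p4:
  fixes f :: "'a::{real_inner, complete_space} \<Rightarrow> real"
    and L R :: real
    and N :: nat
    and x_star :: 'a
    and x y z :: "nat \<Rightarrow> 'a"
  assumes nonzero: "\<exists>v::'a. v \<noteq> 0"
    and L_pos: "L > 0"
    and convex: "convex_on UNIV f"
    and differentiable: "\<forall>u. f differentiable (at u)"
    and smooth: "L_smooth L f"
    and minimizer: "\<forall>u. f x_star \<le> f u"
    and N_ge_1: "N \<ge> 1"
    and R_nonneg: "R \<ge> 0"
    and init_dist: "norm (x 0 - x_star) \<le> R"
    and y_init: "y 0 = x 0"
    and z_init: "z 0 = x 0"
    and y_step: "\<forall>k<N. y (Suc k) = x k - (1 / L) *\<^sub>R gradient f (x k)"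
    and z_step: "\<forall>k<N. z (Suc k) = z k - (fgm_theta k / L) *\<^sub>R gradient f (x k)"
    and x_step: "\<forall>k<N. x (Suc k) =
      (1 - 1 / fgm_theta (Suc k)) *\<^sub>R y (Suc k) + (1 / fgm_theta (Suc k)) *\<^sub>R z (Suc k)"
  shows "f (y N) - f x_star \<le> 2 * L * R\<^sup>2 / ((real N + 2) * (real N + 3))"
proof -
  have N: "0 < N" using N_ge_1 by simp
  have grad: "GDERIV f u :> gradient f u" for u
    using differentiable by (simp add: gderiv_gradient)
  define X where "X k = (if k < N then x k else y N)" for k
  define g where "g k = (1 / L) *\<^sub>R gradient f (X k)" for k
  have interp: "f v / L + (1 / L) *\<^sub>R gradient f v \<bullet> (u - v)
      + (norm ((1 / L) *\<^sub>R gradient f u - (1 / L) *\<^sub>R gradient f v))\<^sup>2 / 2 \<le> f u / L" for u v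
  proof -
    have "norm ((1 / L) *\<^sub>R gradient f u - (1 / L) *\<^sub>R gradient f v)
        = norm (gradient f u - gradient f v) / L"
      using L_pos unfolding scaleR_diff_right[symmetric] norm_scaleR by simp
    moreover have "(f v + gradient f v \<bullet> (u - v) + (norm (gradient f u - gradient f v))\<^sup>2 / (2 * L)) / L \<le> f u / L"
      using smooth_convex_interpolation[OF L_pos grad convex smooth] L_pos by (simp add: divide_right_mono)
    ultimately show ?thesis
      by (simp add: add_divide_distrib power_divide power2_eq_square)
  qed
  have grad_star: "gradient f x_star = 0"
    by (rule gradient_at_minimizer[OF L_pos grad smooth]) (use minimizer in blast)
  have "total_weight N * (f (X N) / L - f x_star / L) \<le> (norm (x 0 - x_star))\<^sup>2 / 2"
  proof (rule fgm_normalized_bound[of N y x z g "\<lambda>k. f (X k) / L", OF N y_init z_init, folded X_def])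
    show "y (Suc k) = x k - g k" "z (Suc k) = z k - fgm_theta k *\<^sub>R g k" if "k < N" for k
      using that y_step z_step by (simp_all add: g_def X_def)
    show "x (Suc k) = (1 - 1 / fgm_theta (Suc k)) *\<^sub>R y (Suc k)
        + (1 / fgm_theta (Suc k)) *\<^sub>R z (Suc k)" if "k < N" for k
      using that x_step by simp
    show "f (X k) / L + g k \<bullet> (x_star - X k) + (norm (g k))\<^sup>2 / 2 \<le> f x_star / L" for k
      using interp[of "X k" x_star] by (simp add: g_def grad_star)
    show "f (X (Suc k)) / L + g (Suc k) \<bullet> (X k - X (Suc k)) + (norm (g k - g (Suc k)))\<^sup>2 / 2
        \<le> f (X k) / L" for k
      using interp[of "X (Suc k)" "X k"] by (simp add: g_def)
  qed
  also have "\<dots> \<le> R\<^sup>2 / 2"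
    using init_dist by (simp add: power_mono)
  finally have "total_weight N * (f (y N) - f x_star) / L \<le> R\<^sup>2 / 2"
    by (simp add: X_def diff_divide_distrib right_diff_distrib)
  then have "f (y N) - f x_star \<le> L * R\<^sup>2 / (2 * total_weight N)"
    using L_pos total_weight_pos[of N] by (simp add: field_simps)
  then show ?thesis by (simp add: total_weight_def mult_ac)
qed

end
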